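(* Let $k\geq2$ be an integer and let $\mathcal{S}$ be a set with $\mathbb{N}\subseteq\mathcal{S}\subseteq\mathbb{A}$, where $\mathbb{A}$ is the set of real algebraic numbers. The decision problem "Given a $k$-regular sequence $(f(n))_{n\geq0}$ over $\mathcal{S}$, is $f(n)\in\Omega(n)$?" is recursively unsolvable.
   Context: $\mathbb{N}$ denotes the positive integers. For $n\in\mathbb{N}_0$ let $(n)_k=n_{s-1}\cdots n_0$ be the standard base-$k$ representation of $n$ (no leading zeros; $(0)_k$ empty). A sequence $(f(n))_{n\geq0}$ with values in $\mathcal{S}$ is $k$-regular if there exist $r\geq0$, a $1\times r$ row vector $v$, an $r\times1$ column vector $w$ and $r\times r$ matrices $M_0,\dots,M_{k-1}$ (with real algebraic entries) such that $f(n)=vM_{n_0}\cdots M_{n_{s-1}}w$ for all $n$. The input of the decision problem is such a linear representation; a real algebraic number is given by its minimal polynomial together with a rational interval containing it and none of its conjugates. $f(n)\in\Omega(g(n))$ means there exist $n_0$ and $c>0$ with $f(n)\geq c\,g(n)$ for all $n\geq n_0$. *)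

theory Defs
  imports Complex_Main "HOL-Computational_Algebra.Polynomial_Factorial" "HOL-Library.Nat_Bijection"
begin

datatype recf = Zero | Succ | Proj nat | Comp recf "recf list" | Prim recf recf | Mn recf

inductive rec_eval :: "recf \<Rightarrow> nat list \<Rightarrow> nat \<Rightarrow> bool" where
  ev_zero: "rec_eval Zero xs 0"
| ev_succ: "rec_eval Succ (x # xs) (Suc x)"
| ev_proj: "i < length xs \<Longrightarrow> rec_eval (Proj i) xs (xs ! i)"
| ev_comp: "list_all2 (\<lambda>g y. rec_eval g xs y) gs ys \<Longrightarrow> rec_eval f ys z
            \<Longrightarrow> rec_eval (Comp f gs) xs z"
| ev_prim0: "rec_eval f xs y \<Longrightarrow> rec_eval (Prim f g) (0 # xs) y"
| ev_primS: "rec_eval (Prim f g) (n # xs) y \<Longrightarrow> rec_eval g (y # n # xs) z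
            \<Longrightarrow> rec_eval (Prim f g) (Suc n # xs) z"
| ev_mn: "rec_eval f (n # xs) 0 \<Longrightarrow> (\<forall>m<n. \<exists>y. rec_eval f (m # xs) (Suc y))
            \<Longrightarrow> rec_eval (Mn f) xs n"

text \<open>A rational number is a pair (numerator, denominator) of integers (denominator > 0).
  A real algebraic number is given by the integer coefficient list (lowest degree first)
  of its minimal polynomial (normalised: irreducible in Z[x], positive leading coefficient)
  together with a closed rational interval containing it and none of its conjugates.\<close>

type_synonym ratc = "int \<times> int"
type_synonym algc = "int list \<times> ratc \<times> ratc"
text \<open>A linear representation: (r, v, w, [M_0,...,M_(k-1)]) with matrices given as lists of rows.\<close>
type_synonym linrep = "nat \<times> algc list \<times> algc list \<times> algc list list list"

definition ratc_valid :: "ratc \<Rightarrow> bool" where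
  "ratc_valid q \<longleftrightarrow> snd q > 0"

definition ratc_val :: "ratc \<Rightarrow> real" where
  "ratc_val q = real_of_int (fst q) / real_of_int (snd q)"

definition alg_denotes :: "algc \<Rightarrow> real \<Rightarrow> bool" where
  "alg_denotes d x \<longleftrightarrow>
     (case d of (cs, lo, hi) \<Rightarrow>
        ratc_valid lo \<and> ratc_valid hi \<and>
        irreducible (Poly cs) \<and> lead_coeff (Poly cs) > 0 \<and>
        poly (map_poly real_of_int (Poly cs)) x = 0 \<and>
        ratc_val lo \<le> x \<and> x \<le> ratc_val hi \<and>
        (\<forall>y. poly (map_poly real_of_int (Poly cs)) y = 0 \<and> ratc_val lo \<le> y \<and> y \<le> ratc_val hi
             \<longrightarrow> y = x))"

definition alg_valid :: "algc \<Rightarrow> bool" where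
  "alg_valid d \<longleftrightarrow> (\<exists>x. alg_denotes d x)"

definition alg_val :: "algc \<Rightarrow> real" where
  "alg_val d = (THE x. alg_denotes d x)"

fun digits :: "nat \<Rightarrow> nat \<Rightarrow> nat list" where
  "digits k n = (if n = 0 \<or> k < 2 then [] else n mod k # digits k (n div k))"

definition vec_mat :: "nat \<Rightarrow> real list \<Rightarrow> real list list \<Rightarrow> real list" where
  "vec_mat r u M = map (\<lambda>j. \<Sum>i<r. u ! i * (M ! i ! j)) [0..<r]"

definition linrep_valid :: "nat \<Rightarrow> linrep \<Rightarrow> bool" where
  "linrep_valid k L \<longleftrightarrow> (case L of (r, v, w, Ms) \<Rightarrow>
     length v = r \<and> length w = r \<and> length Ms = k \<and>
     (\<forall>M\<in>set Ms. length M = r \<and> (\<forall>row\<in>set M. length row = r \<and> (\<forall>d\<in>set row. alg_valid d))) \<and>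
     (\<forall>d\<in>set v. alg_valid d) \<and> (\<forall>d\<in>set w. alg_valid d))"

definition linrep_seq :: "nat \<Rightarrow> linrep \<Rightarrow> nat \<Rightarrow> real" where
  "linrep_seq k L n = (case L of (r, v, w, Ms) \<Rightarrow>
     (let rv = map alg_val v; rw = map alg_val w;
          rM = map (map (map alg_val)) Ms;
          u = foldl (\<lambda>u d. vec_mat r u (rM ! d)) rv (digits k n)
      in \<Sum>i<r. u ! i * rw ! i))"

definition enc_rat :: "ratc \<Rightarrow> nat" where
  "enc_rat q = prod_encode (int_encode (fst q), int_encode (snd q))"

definition enc_alg :: "algc \<Rightarrow> nat" where
  "enc_alg d = (case d of (cs, lo, hi) \<Rightarrow>
     prod_encode (list_encode (map int_encode cs), prod_encode (enc_rat lo, enc_rat hi)))"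

definition enc_linrep :: "linrep \<Rightarrow> nat" where
  "enc_linrep L = (case L of (r, v, w, Ms) \<Rightarrow>
     prod_encode (r, prod_encode (list_encode (map enc_alg v),
       prod_encode (list_encode (map enc_alg w),
         list_encode (map (\<lambda>M. list_encode (map (\<lambda>row. list_encode (map enc_alg row)) M)) Ms)))))"

definition Omega_n :: "(nat \<Rightarrow> real) \<Rightarrow> bool" where
  "Omega_n f \<longleftrightarrow> (\<exists>c>0. \<exists>n0. \<forall>n\<ge>n0. f n \<ge> c * real n)"

definition omega_problem_decidable :: "nat \<Rightarrow> real set \<Rightarrow> bool" where
  "omega_problem_decidable k S \<longleftrightarrow>
     (\<exists>p. \<forall>L. linrep_valid k L \<and> (\<forall>n. linrep_seq k L n \<in> S) \<longrightarrow>
           rec_eval p [enc_linrep L] (if Omega_n (linrep_seq k L) then 1 else 0))"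

end

theory Submission
  imports Defs
begin

text \<open>The undecidability is obtained by self-reference, without a universal machine. A recursive
  function is compiled to a nondeterministic program over finitely many registers whose only
  operations are affine assignments, equality tests, sequencing and nondeterministic iteration,
  and then to finitely many rules. Reading the digits of \<open>n\<close> as a sequence of rules, let \<open>C(n)\<close> be
  the sum of the squares of all violated guards along this sequence, including the final one.
  As all rules are affine, \<open>C(n)\<close> is a quadratic form in the initial registers whose coefficients
  satisfy a linear recurrence in the digits. Hence \<open>f(n) = 1 + k^|n| C(n)\<close> is \<open>k\<close>-regular with positive
  integer values; it exceeds \<open>n\<close> if no run is accepted, and it is 1 infinitely often otherwise.

  The arguments of the program enter only the first entries of the row vector \<open>v\<close>. If \<open>p\<close> decided
  the problem, let \<open>q(r, t, e)\<close> be the value of \<open>p\<close> on the representation of dimension \<open>r\<close> whose row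
  vector consists of the entries for the arguments \<open>r, t, e\<close> followed by the tail coded by \<open>t\<close>, and
  whose remaining data are coded by \<open>e\<close>. Feeding the representation built from \<open>q\<close> with its own
  parameters gives a contradiction.\<close>

subsection \<open>Recursive functions and their closure properties\<close>

inductive_cases rec_eval_ZeroE: "rec_eval Zero xs y"
inductive_cases rec_eval_SuccE: "rec_eval Succ xs y"
inductive_cases rec_eval_ProjE: "rec_eval (Proj i) xs y"
inductive_cases rec_eval_CompE: "rec_eval (Comp f gs) xs y"
inductive_cases rec_eval_PrimE: "rec_eval (Prim f g) xs y"
inductive_cases rec_eval_Prim0E: "rec_eval (Prim f g) (0 # xs) y"
inductive_cases rec_eval_PrimSE: "rec_eval (Prim f g) (Suc n # xs) y"
inductive_cases rec_eval_MnE: "rec_eval (Mn f) xs y"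

lemma list_all2_functional:
  assumes "list_all2 P xs ys" "list_all2 Q xs zs"
    and "\<And>x y z. P x y \<Longrightarrow> Q x z \<Longrightarrow> y = z"
  shows "ys = zs"
  using assms(1,2)
  by (induction xs arbitrary: ys zs) (auto simp: list_all2_Cons1 dest: assms(3))

lemma rec_eval_deterministic:
  assumes "rec_eval p xs y" and "rec_eval p xs z"
  shows "y = z"
  using assms
proof (induction arbitrary: z rule: rec_eval.induct)
  case ev_zero
  then show ?case by (rule rec_eval_ZeroE) simp
next
  case ev_succ
  then show ?case by (rule rec_eval_SuccE) simp
next
  case ev_proj
  show ?case by (rule rec_eval_ProjE[OF ev_proj.prems]) simp
next
  case (ev_comp xs gs ys f z')
  obtain ys' where ys': "list_all2 (\<lambda>g y. rec_eval g xs y) gs ys'" "rec_eval f ys' z"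
    by (rule rec_eval_CompE[OF ev_comp.prems]) (rule that)
  have "ys = ys'"
    by (rule list_all2_functional[OF ev_comp.IH(1) ys'(1)]) blast
  then show ?case using ev_comp.IH(2) ys'(2) by metis
next
  case (ev_prim0 f xs y g)
  show ?case by (rule rec_eval_Prim0E[OF ev_prim0.prems]) (rule ev_prim0.IH)
next
  case (ev_primS f g n xs y z')
  obtain y' where y': "rec_eval (Prim f g) (n # xs) y'" "rec_eval g (y' # n # xs) z"
    by (rule rec_eval_PrimSE[OF ev_primS.prems]) (rule that)
  have "y = y'" by (rule ev_primS.IH(1)[OF y'(1)])
  then show ?case using ev_primS.IH(2) y'(2) by metis
next
  case (ev_mn f n xs)
  have z: "rec_eval f (z # xs) 0" "\<forall>m<z. \<exists>y. rec_eval f (m # xs) (Suc y)"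
    by (rule rec_eval_MnE[OF ev_mn.prems]; assumption)+
  \<comment> \<open>Of two distinct results the smaller one would have to give \<open>f\<close> the
    value 0, being a result itself, and also a positive value, lying below the other result.\<close>
  show ?case
  proof (rule linorder_cases[of n z])
    assume "n < z"
    then obtain y where "rec_eval f (n # xs) (Suc y)" using z(2) by blast
    then have "0 = Suc y" by (rule ev_mn.IH(1))
    then show ?thesis by simp
  next
    assume "z < n"
    then obtain y where "\<forall>x. rec_eval f (z # xs) x \<longrightarrow> Suc y = x" using ev_mn.IH(2) by meson
    then have "Suc y = 0" using z(1) by metis
    then show ?thesis by simp
  qed
qed

text \<open>Serves to show that the code of a linear representation is computable from the numbers
  that describe it.\<close>

definition computable :: "nat \<Rightarrow> (nat list \<Rightarrow> nat) \<Rightarrow> bool" where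
  "computable n f \<longleftrightarrow> (\<exists>p. \<forall>xs. length xs = n \<longrightarrow> rec_eval p xs (f xs))"

lemma computable_cong:
  assumes "computable n f" "\<And>xs. length xs = n \<Longrightarrow> f xs = g xs"
  shows "computable n g"
  using assms unfolding computable_def by auto

lemma computable_proj: "i < n \<Longrightarrow> computable n (\<lambda>xs. xs ! i)"
  unfolding computable_def by (metis ev_proj)

lemma computable_compose:
  assumes "computable (length fs) g" "\<And>f. f \<in> set fs \<Longrightarrow> computable n f"
  shows "computable n (\<lambda>xs. g (map (\<lambda>f. f xs) fs))"
proof -
  obtain pg where pg: "\<And>xs. length xs = length fs \<Longrightarrow> rec_eval pg xs (g xs)"
    using assms(1) unfolding computable_def by blast
  obtain P where P: "\<And>f xs. f \<in> set fs \<Longrightarrow> length xs = n \<Longrightarrow> rec_eval (P f) xs (f xs)"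
    using assms(2) unfolding computable_def by metis
  have "rec_eval (Comp pg (map P fs)) xs (g (map (\<lambda>f. f xs) fs))" if "length xs = n" for xs
    by (rule ev_comp[where ys = "map (\<lambda>f. f xs) fs"])
      (auto simp: list_all2_conv_all_nth intro!: P pg that)
  then show ?thesis unfolding computable_def by blast
qed

lemma computable_compose1:
  assumes "computable 1 (\<lambda>xs. h (xs ! 0))" "computable n f"
  shows "computable n (\<lambda>xs. h (f xs))"
  using computable_compose[of "[f]" "\<lambda>xs. h (xs ! 0)" n] assms by simp

lemma computable_compose2:
  assumes "computable 2 (\<lambda>xs. h (xs ! 0) (xs ! 1))" "computable n f" "computable n g"
  shows "computable n (\<lambda>xs. h (f xs) (g xs))"
  using computable_compose[of "[f, g]" "\<lambda>xs. h (xs ! 0) (xs ! 1)" n] assms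
  by (auto simp: numeral_2_eq_2)

lemma computable_primrec:
  assumes "computable n f" "computable (Suc (Suc n)) g"
    and "\<And>xs. length xs = n \<Longrightarrow> h (0 # xs) = f xs"
    and "\<And>m xs. length xs = n \<Longrightarrow> h (Suc m # xs) = g (h (m # xs) # m # xs)"
  shows "computable (Suc n) h"
proof -
  obtain pf where pf: "\<And>xs. length xs = n \<Longrightarrow> rec_eval pf xs (f xs)"
    using assms(1) unfolding computable_def by blast
  obtain pg where pg: "\<And>xs. length xs = Suc (Suc n) \<Longrightarrow> rec_eval pg xs (g xs)"
    using assms(2) unfolding computable_def by blast
  have "rec_eval (Prim pf pg) (m # xs) (h (m # xs))" if "length xs = n" for m xs
  proof (induction m)
    case 0
    show ?case unfolding assms(3)[OF that] by (rule ev_prim0[OF pf[OF that]])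
  next
    case (Suc m)
    show ?case unfolding assms(4)[OF that] by (rule ev_primS[OF Suc pg]) (simp add: that)
  qed
  then show ?thesis unfolding computable_def
    by (intro exI[of _ "Prim pf pg"]) (auto simp: length_Suc_conv)
qed

lemma computable_Suc:
  assumes "computable n f" shows "computable n (\<lambda>xs. Suc (f xs))"
proof (rule computable_compose1[OF _ assms])
  show "computable 1 (\<lambda>xs. Suc (xs ! 0))"
    unfolding computable_def
    by (intro exI[of _ Succ]) (auto simp: length_Suc_conv intro: ev_succ)
qed

lemma computable_const: "computable n (\<lambda>xs. c)"
proof (induction c)
  case 0
  show ?case unfolding computable_def by (metis ev_zero)
qed (rule computable_Suc)

lemma computable_add:
  assumes "computable n f" "computable n g" shows "computable n (\<lambda>xs. f xs + g xs)"
proof (rule computable_compose2[OF _ assms])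
  have "computable (Suc 1) (\<lambda>xs. xs ! 0 + xs ! 1)"
    by (rule computable_primrec[where f = "\<lambda>xs. xs ! 0" and g = "\<lambda>xs. Suc (xs ! 0)"])
      (auto intro!: computable_Suc computable_proj)
  then show "computable 2 (\<lambda>xs. xs ! 0 + xs ! 1)" by (simp add: numeral_2_eq_2)
qed

lemma computable_mult:
  assumes "computable n f" "computable n g" shows "computable n (\<lambda>xs. f xs * g xs)"
proof (rule computable_compose2[OF _ assms])
  have "computable (Suc 1) (\<lambda>xs. xs ! 0 * xs ! 1)"
    by (rule computable_primrec[where f = "\<lambda>xs. 0" and g = "\<lambda>xs. xs ! 0 + xs ! 2"])
      (auto intro!: computable_const computable_add computable_proj)
  then show "computable 2 (\<lambda>xs. xs ! 0 * xs ! 1)" by (simp add: numeral_2_eq_2)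
qed

lemma computable_pred:
  assumes "computable n f" shows "computable n (\<lambda>xs. f xs - 1)"
proof (rule computable_compose1[OF _ assms])
  have "computable (Suc 0) (\<lambda>xs. xs ! 0 - 1)"
    by (rule computable_primrec[where f = "\<lambda>xs. 0" and g = "\<lambda>xs. xs ! 1"])
      (auto intro!: computable_const computable_proj)
  then show "computable 1 (\<lambda>xs. xs ! 0 - 1)" by simp
qed

lemma computable_triangle:
  assumes "computable n f" shows "computable n (\<lambda>xs. triangle (f xs))"
proof (rule computable_compose1[OF _ assms])
  have "computable (Suc 0) (\<lambda>xs. triangle (xs ! 0))"
    by (rule computable_primrec[where f = "\<lambda>xs. 0" and g = "\<lambda>xs. xs ! 0 + Suc (xs ! 1)"])
      (auto intro!: computable_const computable_proj computable_add computable_Suc)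
  then show "computable 1 (\<lambda>xs. triangle (xs ! 0))" by simp
qed

lemma computable_prod_encode:
  assumes "computable n f" "computable n g"
  shows "computable n (\<lambda>xs. prod_encode (f xs, g xs))"
  unfolding prod_encode_def using assms by (auto intro!: computable_add computable_triangle)

text \<open>\<open>list_encode\<close> builds a code from the right, so entries can be put in front
  of a coded list without decoding it. This is why the entries that depend on the arguments come
  first in the row vector.\<close>

lemma computable_list_encode_append:
  assumes "\<And>a. a \<in> set as \<Longrightarrow> computable n (h a)" "computable n t"
    "\<And>xs. length xs = n \<Longrightarrow> t xs = list_encode (ys xs)"
  shows "computable n (\<lambda>xs. list_encode (map (\<lambda>a. h a xs) as @ ys xs))"
  using assms(1)
proof (induction as)
  case Nil
  show ?case using assms(2,3) computable_cong by fastforce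
next
  case (Cons a as)
  then show ?case by (auto intro!: computable_Suc computable_prod_encode)
qed

section \<open>Integers as coded algebraic numbers\<close>

definition int_alg :: "int \<Rightarrow> algc" where
  "int_alg z = ([- z, 1], (z, 1), (z, 1))"

text \<open>A constant factor over the integers need not be a unit. Here the leading coefficients of
  the two factors multiply to 1, so the factor of degree 0 is one.\<close>

lemma irreducible_monic_linear_int: "irreducible [:a, 1::int:]"
proof (rule irreducibleI)
  fix p q assume pq: "[:a, 1:] = p * q"
  have nz: "p \<noteq> 0" "q \<noteq> 0" using pq by auto
  have lc: "lead_coeff p * lead_coeff q = 1"
    using arg_cong[OF pq, of lead_coeff] by (simp add: lead_coeff_mult)
  have dg: "degree p + degree q = 1"
    using arg_cong[OF pq, of degree] nz by (simp add: degree_mult_eq)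
  have unit: "r dvd 1" if "degree r = 0" "lead_coeff r dvd 1" for r :: "int poly"
    using that by (auto elim!: degree_eq_zeroE simp: is_unit_const_poly_iff)
  have "degree p = 0 \<or> degree q = 0" using dg by auto
  then show "p dvd 1 \<or> q dvd 1"
    using unit lc by (metis dvd_triv_left dvd_triv_right)
qed (auto simp: is_unit_poly_iff)

lemma alg_denotes_int_alg: "alg_denotes (int_alg z) x \<longleftrightarrow> x = of_int z"
  using irreducible_monic_linear_int[of "- z"]
  by (auto simp: alg_denotes_def int_alg_def ratc_valid_def ratc_val_def map_poly_pCons)

lemma alg_valid_int_alg: "alg_valid (int_alg z)"
  by (simp add: alg_valid_def alg_denotes_int_alg)

lemma alg_val_int_alg: "alg_val (int_alg z) = of_int z"
  by (simp add: alg_val_def alg_denotes_int_alg)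

lemma int_encode_nonneg: "int_encode (int m) = 2 * m"
  by (simp add: int_encode_def sum_encode_def)

text \<open>Truncated subtraction makes the formula right at \<open>m = 0\<close> as well, where
  both sides are 0; hence a predecessor suffices to compute the code.\<close>

lemma int_encode_nonpos: "int_encode (- int m) = 2 * m - 1"
  by (cases m) (auto simp: int_encode_def sum_encode_def nat_add_distrib nat_mult_distrib)

lemma computable_enc_int_alg:
  assumes "computable n f"
  shows "computable n (\<lambda>xs. enc_alg (int_alg (int (f xs))))"
  unfolding enc_alg_def int_alg_def enc_rat_def split list.map list_encode.simps
    fst_conv snd_conv int_encode_nonneg int_encode_nonpos
  by (intro computable_prod_encode computable_Suc computable_pred computable_mult
      computable_const assms)

subsection \<open>Affine register programs\<close>

text \<open>The operations keep the later cost quadratic: substituting an affine assignment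
  preserves degree 2, and a failed equality test is measured by one square. Inequalities have no
  test of their own and are replaced by guessing.\<close>

datatype act = Aff nat nat nat nat | Eq nat nat

datatype prog = Act act | Seq prog prog | Star prog

type_synonym store = "nat \<Rightarrow> nat"

fun act_sem :: "act \<Rightarrow> (store \<times> store) set" where
  "act_sem (Aff i m j c) = {(\<sigma>, \<sigma>(i := m * \<sigma> j + c)) |\<sigma>. True}"
| "act_sem (Eq i j) = {(\<sigma>, \<sigma>) |\<sigma>. \<sigma> i = \<sigma> j}"

fun prog_sem :: "prog \<Rightarrow> (store \<times> store) set" where
  "prog_sem (Act a) = act_sem a"
| "prog_sem (Seq p q) = prog_sem p O prog_sem q"
| "prog_sem (Star p) = (prog_sem p)\<^sup>*"

text \<open>Cells 0 and 1 are reserved for the constant 1 and the program counter.\<close>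

fun act_ok :: "act \<Rightarrow> bool" where
  "act_ok (Aff i m j c) \<longleftrightarrow> 2 \<le> i \<and> 2 \<le> j"
| "act_ok (Eq i j) \<longleftrightarrow> 2 \<le> i \<and> 2 \<le> j"

fun prog_ok :: "prog \<Rightarrow> bool" where
  "prog_ok (Act a) \<longleftrightarrow> act_ok a"
| "prog_ok (Seq p q) \<longleftrightarrow> prog_ok p \<and> prog_ok q"
| "prog_ok (Star p) \<longleftrightarrow> prog_ok p"

abbreviation "Set_to i c \<equiv> Act (Aff i 0 i c)"
abbreviation "Copy i j \<equiv> Act (Aff i 1 j 0)"
abbreviation "Inc i \<equiv> Act (Aff i 1 i 1)"
abbreviation "Test i j \<equiv> Act (Eq i j)"

section \<open>Implementing recursive functions by register programs\<close>

definition frame :: "nat \<Rightarrow> nat set \<Rightarrow> store \<Rightarrow> store \<Rightarrow> bool" where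
  "frame b W \<sigma> \<sigma>' \<longleftrightarrow> (\<forall>i<b. i \<notin> W \<longrightarrow> \<sigma>' i = \<sigma> i)"

lemma frame_refl [simp]: "frame b W \<sigma> \<sigma>"
  by (simp add: frame_def)

lemma frame_trans:
  "frame b W \<sigma> \<sigma>' \<Longrightarrow> frame b W \<sigma>' \<sigma>'' \<Longrightarrow> frame b W \<sigma> \<sigma>''"
  by (simp add: frame_def)

lemma frame_upd: "frame b W \<sigma> \<sigma>' \<Longrightarrow> i \<in> W \<or> b \<le> i \<Longrightarrow> frame b W \<sigma> (\<sigma>'(i := v))"
  by (auto simp: frame_def)

lemma frame_map: "frame b W \<sigma> \<sigma>' \<Longrightarrow> set as \<subseteq> {..<b} \<Longrightarrow> W \<inter> set as = {} \<Longrightarrow> map \<sigma>' as = map \<sigma> as"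
  by (auto simp: frame_def subset_iff)

text \<open>Programs are nondeterministic and may block, so correctness has two halves: no completed
  run delivers a wrong value, and every value is delivered by some run. Registers from
  \<open>b\<close> on are scratch space.\<close>

definition implements :: "prog \<Rightarrow> recf \<Rightarrow> nat list \<Rightarrow> nat \<Rightarrow> nat \<Rightarrow> bool" where
  "implements c p as out b \<longleftrightarrow> prog_ok c \<and>
     (\<forall>\<sigma> \<sigma>'. (\<sigma>, \<sigma>') \<in> prog_sem c \<longrightarrow>
        frame b {out} \<sigma> \<sigma>' \<and> rec_eval p (map \<sigma> as) (\<sigma>' out)) \<and>
     (\<forall>\<sigma> y. rec_eval p (map \<sigma> as) y \<longrightarrow>
        (\<exists>\<sigma>'. (\<sigma>, \<sigma>') \<in> prog_sem c \<and> frame b {out} \<sigma> \<sigma>' \<and> \<sigma>' out = y))"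

lemma implementsI:
  assumes "prog_ok c"
    and "\<And>\<sigma> \<sigma>'. (\<sigma>, \<sigma>') \<in> prog_sem c \<Longrightarrow> frame b {out} \<sigma> \<sigma>' \<and> rec_eval p (map \<sigma> as) (\<sigma>' out)"
    and "\<And>\<sigma> y. rec_eval p (map \<sigma> as) y \<Longrightarrow>
        \<exists>\<sigma>'. (\<sigma>, \<sigma>') \<in> prog_sem c \<and> frame b {out} \<sigma> \<sigma>' \<and> \<sigma>' out = y"
  shows "implements c p as out b"
  using assms unfolding implements_def by blast

lemma implements_ok: "implements c p as out b \<Longrightarrow> prog_ok c"
  by (simp add: implements_def)

lemma implements_sound:
  assumes "implements c p as out b" "(\<sigma>, \<sigma>') \<in> prog_sem c"
  shows "frame b {out} \<sigma> \<sigma>'" "rec_eval p (map \<sigma> as) (\<sigma>' out)"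
  using assms unfolding implements_def by blast+

lemma implements_complete:
  assumes "implements c p as out b" "rec_eval p (map \<sigma> as) y"
  obtains \<sigma>' where "(\<sigma>, \<sigma>') \<in> prog_sem c" "frame b {out} \<sigma> \<sigma>'" "\<sigma>' out = y"
  using assms unfolding implements_def by blast

text \<open>Comparing a register set to 0 with one set to 1 blocks every run. This serves argument
  lists that are too short for the function to have a value.\<close>

lemma implements_empty:
  assumes "2 \<le> b" "\<And>\<sigma> y. \<not> rec_eval p (map \<sigma> as) y"
  shows "implements (Seq (Set_to b 0) (Seq (Set_to (Suc b) 1) (Test b (Suc b)))) p as out b"
  using assms by (intro implementsI) auto

text \<open>Quantifying over all layouts makes the notion inductive: a subprogram is placed on
  scratch registers of the enclosing program. As \<open>out\<close> is not an argument register, the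
  arguments survive the call.\<close>

definition implementable :: "recf \<Rightarrow> bool" where
  "implementable p \<longleftrightarrow> (\<forall>as out b. set as \<subseteq> {2..<b} \<longrightarrow> out \<in> {2..<b} \<longrightarrow> out \<notin> set as \<longrightarrow>
     (\<exists>c. implements c p as out b))"

lemma implementableD:
  assumes "implementable p" "set as \<subseteq> {2..<b}" "2 \<le> out" "out < b" "out \<notin> set as"
  obtains c where "implements c p as out b"
  using assms unfolding implementable_def by (meson atLeastLessThan_iff)

lemma implementable_Zero: "implementable Zero"
  unfolding implementable_def
proof (intro allI impI)
  fix as :: "nat list" and out b :: nat
  assume "out \<in> {2..<b}"
  then have "implements (Set_to out 0) Zero as out b"
    by (intro implementsI) (auto simp: frame_def elim: rec_eval_ZeroE intro: ev_zero)
  then show "\<exists>c. implements c Zero as out b" ..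
qed

lemma implementable_Succ: "implementable Succ"
  unfolding implementable_def
proof (intro allI impI)
  fix as :: "nat list" and out b :: nat
  assume as: "set as \<subseteq> {2..<b}" and out: "out \<in> {2..<b}"
  show "\<exists>c. implements c Succ as out b"
  proof (cases as)
    case Nil
    have "implements (Seq (Set_to b 0) (Seq (Set_to (Suc b) 1) (Test b (Suc b)))) Succ as out b"
      using out Nil by (intro implements_empty) (auto elim: rec_eval_SuccE)
    then show ?thesis ..
  next
    case (Cons a as')
    have "implements (Act (Aff out 1 a 1)) Succ as out b"
      using as out Cons by (intro implementsI) (auto simp: frame_def elim: rec_eval_SuccE intro: ev_succ)
    then show ?thesis ..
  qed
qed

lemma implementable_Proj: "implementable (Proj i)"
  unfolding implementable_def
proof (intro allI impI)
  fix as :: "nat list" and out b :: nat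
  assume as: "set as \<subseteq> {2..<b}" and out: "out \<in> {2..<b}"
  show "\<exists>c. implements c (Proj i) as out b"
  proof (cases "i < length as")
    case False
    have "implements (Seq (Set_to b 0) (Seq (Set_to (Suc b) 1) (Test b (Suc b)))) (Proj i) as out b"
      using out False by (intro implements_empty) (auto elim: rec_eval_ProjE)
    then show ?thesis ..
  next
    case True
    have "rec_eval (Proj i) (map \<sigma> as) (\<sigma> (as ! i))" for \<sigma>
      using ev_proj[of i "map \<sigma> as"] True by simp
    moreover have "y = \<sigma> (as ! i)" if "rec_eval (Proj i) (map \<sigma> as) y" for \<sigma> y
      using rec_eval_ProjE[OF that] True by auto
    moreover have "2 \<le> as ! i" using as nth_mem[OF True] by auto
    ultimately have "implements (Copy out (as ! i)) (Proj i) as out b"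
      using out by (intro implementsI) (auto simp: frame_def)
    then show ?thesis ..
  qed
qed

text \<open>The results go to the consecutive registers from \<open>t\<close> on. Each later
  evaluation runs with a larger bound, which protects the results already stored.\<close>

lemma implementable_list:
  assumes "\<And>g. g \<in> set gs \<Longrightarrow> implementable g"
    and "set as \<subseteq> {2..<t}" "2 \<le> t"
  shows "\<exists>c. prog_ok c \<and>
     (\<forall>\<sigma> \<sigma>'. (\<sigma>, \<sigma>') \<in> prog_sem c \<longrightarrow> frame t {} \<sigma> \<sigma>' \<and>
        list_all2 (\<lambda>g y. rec_eval g (map \<sigma> as) y) gs (map \<sigma>' [t..<t + length gs])) \<and>
     (\<forall>\<sigma> ys. list_all2 (\<lambda>g y. rec_eval g (map \<sigma> as) y) gs ys \<longrightarrow>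
        (\<exists>\<sigma>'. (\<sigma>, \<sigma>') \<in> prog_sem c \<and> frame t {} \<sigma> \<sigma>' \<and> map \<sigma>' [t..<t + length gs] = ys))"
  using assms
proof (induction gs arbitrary: t)
  case Nil
  \<comment> \<open>This test always succeeds and changes nothing, so it serves as the empty
    program.\<close>
  show ?case by (rule exI[of _ "Test 2 2"]) auto
next
  case (Cons g gs)
  have g: "implementable g" using Cons.prems by simp
  obtain c where c: "implements c g as t (Suc t)"
    by (rule implementableD[OF g, of as "Suc t" t]) (use Cons.prems in auto)
  have sub: "set as \<subseteq> {2..<Suc t}" "t \<notin> set as" "set as \<subseteq> {..<t}" "set as \<subseteq> {..<Suc t}"
    using Cons.prems by auto
  have upt: "[t..<t + length (g # gs)] = t # [Suc t..<Suc t + length gs]"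
    by (simp add: upt_rec)
  obtain d where d: "prog_ok d"
    "\<And>\<sigma> \<sigma>'. (\<sigma>, \<sigma>') \<in> prog_sem d \<Longrightarrow> frame (Suc t) {} \<sigma> \<sigma>' \<and>
        list_all2 (\<lambda>g y. rec_eval g (map \<sigma> as) y) gs (map \<sigma>' [Suc t..<Suc t + length gs])"
    "\<And>\<sigma> ys. list_all2 (\<lambda>g y. rec_eval g (map \<sigma> as) y) gs ys \<Longrightarrow>
        \<exists>\<sigma>'. (\<sigma>, \<sigma>') \<in> prog_sem d \<and> frame (Suc t) {} \<sigma> \<sigma>' \<and> map \<sigma>' [Suc t..<Suc t + length gs] = ys"
    using Cons.IH[OF _ sub(1)] Cons.prems(1,3) by (auto simp del: upt_Suc add_Suc)
  show ?case
  proof (intro exI[of _ "Seq c d"] conjI allI impI)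
    show "prog_ok (Seq c d)" using c d(1) by (simp add: implements_ok)
  next
    fix \<sigma> \<sigma>' assume "(\<sigma>, \<sigma>') \<in> prog_sem (Seq c d)"
    then obtain \<tau> where \<tau>: "(\<sigma>, \<tau>) \<in> prog_sem c" "(\<tau>, \<sigma>') \<in> prog_sem d" by auto
    note cs = implements_sound[OF c \<tau>(1)] and ds = d(2)[OF \<tau>(2)]
    have eq: "map \<tau> as = map \<sigma> as" using frame_map[OF cs(1) sub(4)] sub(2) by simp
    have "\<sigma>' t = \<tau> t" using ds by (simp add: frame_def)
    then show "list_all2 (\<lambda>g y. rec_eval g (map \<sigma> as) y) (g # gs) (map \<sigma>' [t..<t + length (g # gs)])"
      unfolding upt using cs(2) ds eq by simp
    show "frame t {} \<sigma> \<sigma>'" using cs(1) ds by (auto simp: frame_def)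
  next
    fix \<sigma> ys assume "list_all2 (\<lambda>g y. rec_eval g (map \<sigma> as) y) (g # gs) ys"
    then obtain z zs where ys: "ys = z # zs" "rec_eval g (map \<sigma> as) z"
      "list_all2 (\<lambda>g y. rec_eval g (map \<sigma> as) y) gs zs"
      by (auto simp: list_all2_Cons1)
    obtain \<tau> where \<tau>: "(\<sigma>, \<tau>) \<in> prog_sem c" "frame (Suc t) {t} \<sigma> \<tau>" "\<tau> t = z"
      using implements_complete[OF c ys(2)] .
    have eq: "map \<tau> as = map \<sigma> as" using frame_map[OF \<tau>(2) sub(4)] sub(2) by simp
    obtain \<sigma>' where \<sigma>': "(\<tau>, \<sigma>') \<in> prog_sem d" "frame (Suc t) {} \<tau> \<sigma>'"
      "map \<sigma>' [Suc t..<Suc t + length gs] = zs"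
      using d(3)[of \<tau> zs] ys(3) eq by auto
    have "\<sigma>' t = z" using \<sigma>'(2) \<tau>(3) by (simp add: frame_def)
    moreover have "frame t {} \<sigma> \<sigma>'" using \<tau>(2) \<sigma>'(2) by (auto simp: frame_def)
    ultimately show "\<exists>\<sigma>'. (\<sigma>, \<sigma>') \<in> prog_sem (Seq c d) \<and> frame t {} \<sigma> \<sigma>' \<and>
        map \<sigma>' [t..<t + length (g # gs)] = ys"
      unfolding upt using \<tau>(1) \<sigma>' ys(1) by auto
  qed
qed

lemma implementable_Comp:
  assumes "implementable f" "\<And>g. g \<in> set gs \<Longrightarrow> implementable g"
  shows "implementable (Comp f gs)"
  unfolding implementable_def
proof (intro allI impI)
  fix as :: "nat list" and out b :: nat
  assume as: "set as \<subseteq> {2..<b}" and out: "out \<in> {2..<b}" and "out \<notin> set as"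
  let ?ts = "[b..<b + length gs]"
  obtain d where d: "prog_ok d"
    "\<And>\<sigma> \<sigma>'. (\<sigma>, \<sigma>') \<in> prog_sem d \<Longrightarrow> frame b {} \<sigma> \<sigma>' \<and>
        list_all2 (\<lambda>g y. rec_eval g (map \<sigma> as) y) gs (map \<sigma>' ?ts)"
    "\<And>\<sigma> ys. list_all2 (\<lambda>g y. rec_eval g (map \<sigma> as) y) gs ys \<Longrightarrow>
        \<exists>\<sigma>'. (\<sigma>, \<sigma>') \<in> prog_sem d \<and> frame b {} \<sigma> \<sigma>' \<and> map \<sigma>' ?ts = ys"
    using implementable_list[of gs as b] assms(2) as out by auto
  obtain c where c: "implements c f ?ts out (b + length gs)"
    by (rule implementableD[OF assms(1), of ?ts "b + length gs" out]) (use out in auto)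
  have "implements (Seq d c) (Comp f gs) as out b"
  proof (rule implementsI)
    show "prog_ok (Seq d c)" using d(1) c by (simp add: implements_ok)
  next
    fix \<sigma> \<sigma>' assume "(\<sigma>, \<sigma>') \<in> prog_sem (Seq d c)"
    then obtain \<tau> where \<tau>: "(\<sigma>, \<tau>) \<in> prog_sem d" "(\<tau>, \<sigma>') \<in> prog_sem c" by auto
    note cs = implements_sound[OF c \<tau>(2)] and ds = d(2)[OF \<tau>(1)]
    show "frame b {out} \<sigma> \<sigma>' \<and> rec_eval (Comp f gs) (map \<sigma> as) (\<sigma>' out)"
      using cs ds by (auto simp: frame_def intro: ev_comp)
  next
    fix \<sigma> y assume "rec_eval (Comp f gs) (map \<sigma> as) y"
    then obtain ys where ys: "list_all2 (\<lambda>g y. rec_eval g (map \<sigma> as) y) gs ys" "rec_eval f ys y"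
      by (rule rec_eval_CompE)
    obtain \<tau> where \<tau>: "(\<sigma>, \<tau>) \<in> prog_sem d" "frame b {} \<sigma> \<tau>" "map \<tau> ?ts = ys"
      using d(3)[OF ys(1)] by blast
    obtain \<sigma>' where \<sigma>': "(\<tau>, \<sigma>') \<in> prog_sem c" "frame (b + length gs) {out} \<tau> \<sigma>'" "\<sigma>' out = y"
      using implements_complete[OF c, of \<tau> y] ys(2) \<tau>(3) by blast
    then show "\<exists>\<sigma>'. (\<sigma>, \<sigma>') \<in> prog_sem (Seq d c) \<and> frame b {out} \<sigma> \<sigma>' \<and> \<sigma>' out = y"
      using \<tau> by (auto simp: frame_def)
  qed
  then show "\<exists>c. implements c (Comp f gs) as out b" ..
qed

text \<open>A loop keeps in \<open>acc\<close> the value of the recursion at the counter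
  \<open>i\<close>. The number of rounds is guessed, and the test of \<open>i\<close> against the
  first argument afterwards admits only the right guess.\<close>

lemma implementable_Prim:
  assumes "implementable f" "implementable g"
  shows "implementable (Prim f g)"
  unfolding implementable_def
proof (intro allI impI)
  fix as :: "nat list" and out b :: nat
  assume as: "set as \<subseteq> {2..<b}" and out: "out \<in> {2..<b}" and oas: "out \<notin> set as"
  show "\<exists>c. implements c (Prim f g) as out b"
  proof (cases as)
    case Nil
    have "implements (Seq (Set_to b 0) (Seq (Set_to (Suc b) 1) (Test b (Suc b)))) (Prim f g) as out b"
      using out Nil by (intro implements_empty) (auto elim: rec_eval_PrimE)
    then show ?thesis ..
  next
    case (Cons a rs)
    define i acc tmp B where "i = b" and "acc = b + 1" and "tmp = b + 2" and "B = b + 3"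
    note regs = i_def acc_def tmp_def B_def
    have a: "a < b" "2 \<le> a" and rs: "set rs \<subseteq> {..<b}" "i \<notin> set rs" "acc \<notin> set rs" "tmp \<notin> set rs"
      using as Cons by (auto simp: regs)
    obtain cf where cf: "implements cf f rs acc B"
      by (rule implementableD[OF assms(1), of rs B acc]) (use as Cons out in \<open>auto simp: regs\<close>)
    obtain cg where cg: "implements cg g (acc # i # rs) tmp B"
      by (rule implementableD[OF assms(2), of "acc # i # rs" B tmp])
        (use as Cons out in \<open>auto simp: regs\<close>)
    define body where "body = Seq cg (Seq (Copy acc tmp) (Inc i))"
    define c where "c = Seq cf (Seq (Set_to i 0) (Seq (Star body) (Seq (Test i a) (Copy out acc))))"
    have eq_rs: "map \<tau> rs = map \<sigma> rs" if "frame b {} \<sigma> \<tau>" for \<sigma> \<tau>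
      using frame_map[OF that rs(1)] by simp
    have fr: "frame b {} \<sigma> \<tau>" if "frame B {r} \<sigma> \<tau>" "b \<le> r" for \<sigma> \<tau> r
      using that by (auto simp: frame_def regs)
    have iter: "frame b {} \<sigma> \<sigma>' \<and> \<sigma>' i = Suc (\<sigma> i) \<and> rec_eval g (\<sigma> acc # \<sigma> i # map \<sigma> rs) (\<sigma>' acc)"
      if sem: "(\<sigma>, \<sigma>') \<in> prog_sem body" for \<sigma> \<sigma>'
    proof -
      obtain \<tau> where \<tau>: "(\<sigma>, \<tau>) \<in> prog_sem cg" "\<sigma>' = \<tau>(acc := \<tau> tmp, i := Suc (\<tau> i))"
        using sem by (auto simp: body_def regs)
      note s = implements_sound[OF cg \<tau>(1)]
      have "frame b {} \<sigma> \<sigma>'" unfolding \<tau>(2) by (intro frame_upd fr[OF s(1)]) (auto simp: regs)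
      moreover have "\<tau> i = \<sigma> i" using s(1) by (auto simp: frame_def regs)
      ultimately show ?thesis using s(2) \<tau>(2) by (simp add: regs)
    qed
    have loop: "frame b {} \<sigma> \<sigma>' \<and> rec_eval (Prim f g) (\<sigma>' i # map \<sigma> rs) (\<sigma>' acc)"
      if "(\<sigma>, \<sigma>') \<in> (prog_sem body)\<^sup>*" "rec_eval (Prim f g) (\<sigma> i # map \<sigma> rs) (\<sigma> acc)" for \<sigma> \<sigma>'
      using that(1)
    proof (induction rule: rtrancl_induct)
      case base then show ?case using that(2) by simp
    next
      case (step \<tau> \<tau>')
      from step.IH have fr\<tau>: "frame b {} \<sigma> \<tau>"
        and ev: "rec_eval (Prim f g) (\<tau> i # map \<sigma> rs) (\<tau> acc)" by auto
      have s: "frame b {} \<tau> \<tau>'" "\<tau>' i = Suc (\<tau> i)" "rec_eval g (\<tau> acc # \<tau> i # map \<tau> rs) (\<tau>' acc)"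
        using iter[OF step.hyps(2)] by auto
      then show ?case using frame_trans[OF fr\<tau> s(1)] ev_primS[OF ev] eq_rs[OF fr\<tau>] by simp
    qed
    have loop_complete: "\<exists>\<sigma>'. (\<sigma>, \<sigma>') \<in> (prog_sem body)\<^sup>* \<and> frame b {} \<sigma> \<sigma>' \<and> \<sigma>' i = n \<and> \<sigma>' acc = y"
      if "rec_eval (Prim f g) (n # map \<sigma> rs) y" "\<sigma> i = 0" "rec_eval f (map \<sigma> rs) (\<sigma> acc)" for \<sigma> n y
      using that(1)
    proof (induction n arbitrary: y)
      case 0
      then have "rec_eval f (map \<sigma> rs) y" by (rule rec_eval_Prim0E)
      \<comment> \<open>The loop starts from the value that the program found for \<open>f\<close>;
        determinism identifies it with the given one.\<close>
      then have "y = \<sigma> acc" using that(3) by (rule rec_eval_deterministic)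
      then show ?case using that(2) by (intro exI[of _ \<sigma>]) simp
    next
      case (Suc n)
      obtain y0 where y0: "rec_eval (Prim f g) (n # map \<sigma> rs) y0" "rec_eval g (y0 # n # map \<sigma> rs) y"
        using Suc.prems by (rule rec_eval_PrimSE)
      obtain \<tau> where \<tau>: "(\<sigma>, \<tau>) \<in> (prog_sem body)\<^sup>*" "frame b {} \<sigma> \<tau>" "\<tau> i = n" "\<tau> acc = y0"
        using Suc.IH[OF y0(1)] by blast
      obtain \<tau>' where \<tau>': "(\<tau>, \<tau>') \<in> prog_sem cg" "frame B {tmp} \<tau> \<tau>'" "\<tau>' tmp = y"
        using implements_complete[OF cg, of \<tau> y] y0(2) \<tau>(3,4) eq_rs[OF \<tau>(2)] by auto
      define \<sigma>' where "\<sigma>' = \<tau>'(acc := \<tau>' tmp, i := Suc (\<tau>' i))"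
      have "(\<tau>, \<sigma>') \<in> prog_sem body"
        using \<tau>'(1) by (auto simp: body_def \<sigma>'_def regs intro!: relcompI)
      moreover have "frame b {} \<tau> \<sigma>'"
        unfolding \<sigma>'_def by (intro frame_upd fr[OF \<tau>'(2)]) (auto simp: regs)
      moreover have "\<sigma>' i = Suc n" "\<sigma>' acc = y"
        using \<tau>'(2,3) \<tau>(3) by (auto simp: \<sigma>'_def regs frame_def)
      ultimately show ?case
        using rtrancl_into_rtrancl[OF \<tau>(1)] frame_trans[OF \<tau>(2)] by blast
    qed
    have "implements c (Prim f g) as out b"
    proof (rule implementsI)
      show "prog_ok c" using cf cg out a by (auto simp: c_def body_def regs implements_ok)
    next
      fix \<sigma> \<sigma>' assume "(\<sigma>, \<sigma>') \<in> prog_sem c"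
      then obtain \<tau> \<tau>' where \<tau>: "(\<sigma>, \<tau>) \<in> prog_sem cf" "(\<tau>(i := 0), \<tau>') \<in> (prog_sem body)\<^sup>*"
        "\<tau>' i = \<tau>' a" "\<sigma>' = \<tau>'(out := \<tau>' acc)"
        by (auto simp: c_def)
      note s = implements_sound[OF cf \<tau>(1)]
      have fr0: "frame b {} \<sigma> (\<tau>(i := 0))"
        by (intro frame_upd fr[OF s(1)]) (auto simp: regs)
      have "rec_eval (Prim f g) ((\<tau>(i := 0)) i # map (\<tau>(i := 0)) rs) ((\<tau>(i := 0)) acc)"
        unfolding eq_rs[OF fr0] using s(2) by (simp add: regs ev_prim0)
      from loop[OF \<tau>(2) this] have fr1: "frame b {} (\<tau>(i := 0)) \<tau>'"
        and ev: "rec_eval (Prim f g) (\<tau>' i # map (\<tau>(i := 0)) rs) (\<tau>' acc)" by blast+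
      have fr2: "frame b {} \<sigma> \<tau>'" using frame_trans[OF fr0 fr1] .
      then have "\<tau>' i = \<sigma> a" using \<tau>(3) a(1) by (simp add: frame_def)
      then show "frame b {out} \<sigma> \<sigma>' \<and> rec_eval (Prim f g) (map \<sigma> as) (\<sigma>' out)"
        using ev fr2 \<tau>(4) eq_rs[OF fr0] Cons by (auto simp: frame_def)
    next
      fix \<sigma> y assume ev: "rec_eval (Prim f g) (map \<sigma> as) y"
      \<comment> \<open>A derivation at any counter unwinds to one at 0. This supplies the value of
        \<open>f\<close> with which the program has to begin.\<close>
      have "\<exists>z. rec_eval f (map \<sigma> rs) z" if "rec_eval (Prim f g) (n # map \<sigma> rs) y" for n y
        using that
      proof (induction n arbitrary: y)
        case 0
        then show ?case by (rule rec_eval_Prim0E) blast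
      next
        case (Suc n)
        from Suc.prems obtain y' where "rec_eval (Prim f g) (n # map \<sigma> rs) y'"
          by (rule rec_eval_PrimSE)
        then show ?case by (rule Suc.IH)
      qed
      then obtain z where z: "rec_eval f (map \<sigma> rs) z" using ev Cons by auto
      obtain \<tau> where \<tau>: "(\<sigma>, \<tau>) \<in> prog_sem cf" "frame B {acc} \<sigma> \<tau>" "\<tau> acc = z"
        using implements_complete[OF cf z] .
      have fr0: "frame b {} \<sigma> (\<tau>(i := 0))"
        by (intro frame_upd fr[OF \<tau>(2)]) (auto simp: regs)
      have "\<exists>\<tau>'. (\<tau>(i := 0), \<tau>') \<in> (prog_sem body)\<^sup>* \<and> frame b {} (\<tau>(i := 0)) \<tau>' \<and>
          \<tau>' i = \<sigma> a \<and> \<tau>' acc = y"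
      proof (rule loop_complete)
        show "rec_eval (Prim f g) (\<sigma> a # map (\<tau>(i := 0)) rs) y"
          unfolding eq_rs[OF fr0] using ev Cons by simp
        show "rec_eval f (map (\<tau>(i := 0)) rs) ((\<tau>(i := 0)) acc)"
          unfolding eq_rs[OF fr0] using z \<tau>(3) by (simp add: regs)
      qed simp
      then obtain \<tau>' where \<tau>': "(\<tau>(i := 0), \<tau>') \<in> (prog_sem body)\<^sup>*" "frame b {} (\<tau>(i := 0)) \<tau>'"
        "\<tau>' i = \<sigma> a" "\<tau>' acc = y" by blast
      have fr2: "frame b {} \<sigma> \<tau>'" using frame_trans[OF fr0 \<tau>'(2)] .
      then have "\<tau>' i = \<tau>' a" using \<tau>'(3) a(1) by (simp add: frame_def)
      then have "(\<sigma>, \<tau>'(out := \<tau>' acc)) \<in> prog_sem c"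
        using \<tau>(1) \<tau>'(1) by (auto simp: c_def intro!: relcompI)
      moreover have "frame b {out} \<sigma> (\<tau>'(out := \<tau>' acc))" using fr2 by (auto simp: frame_def)
      ultimately show "\<exists>\<sigma>'. (\<sigma>, \<sigma>') \<in> prog_sem c \<and> frame b {out} \<sigma> \<sigma>' \<and> \<sigma>' out = y"
        using \<tau>'(4) by (intro exI[of _ "\<tau>'(out := \<tau>' acc)"]) auto
    qed
    then show ?thesis ..
  qed
qed

text \<open>This is how a program guesses a number: iterating an increment reaches every value from
  the present one on.\<close>

lemma star_inc: "(\<sigma>, \<sigma>') \<in> (act_sem (Aff u 1 u 1))\<^sup>* \<longleftrightarrow> (\<exists>n. \<sigma>' = \<sigma>(u := \<sigma> u + n))"
proof
  assume "(\<sigma>, \<sigma>') \<in> (act_sem (Aff u 1 u 1))\<^sup>*"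
  then show "\<exists>n. \<sigma>' = \<sigma>(u := \<sigma> u + n)"
  proof (induction rule: rtrancl_induct)
    case base
    show ?case by (rule exI[of _ 0]) simp
  next
    case (step \<tau> \<tau>')
    then obtain n where "\<tau> = \<sigma>(u := \<sigma> u + n)" by blast
    then show ?case using step.hyps(2) by (intro exI[of _ "Suc n"]) auto
  qed
next
  assume "\<exists>n. \<sigma>' = \<sigma>(u := \<sigma> u + n)"
  then obtain n where "\<sigma>' = \<sigma>(u := \<sigma> u + n)" ..
  moreover have "(\<sigma>, \<sigma>(u := \<sigma> u + n)) \<in> (act_sem (Aff u 1 u 1))\<^sup>*"
  proof (induction n)
    case (Suc n)
    have "(\<sigma>(u := \<sigma> u + n), \<sigma>(u := \<sigma> u + Suc n)) \<in> act_sem (Aff u 1 u 1)"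
      by (auto intro!: exI[of _ "\<sigma>(u := \<sigma> u + n)"])
    then show ?case using Suc by (rule rtrancl_into_rtrancl[rotated])
  qed simp
  ultimately show "(\<sigma>, \<sigma>') \<in> (act_sem (Aff u 1 u 1))\<^sup>*" by simp
qed

text \<open>Each round of the loop checks that \<open>f\<close> is positive at the counter
  \<open>i\<close> before increasing it. The loop may be left at any time, but the evaluation after
  it has to give 0, so a completed run stops exactly at the least zero.\<close>

lemma implementable_Mn:
  assumes "implementable f"
  shows "implementable (Mn f)"
  unfolding implementable_def
proof (intro allI impI)
  fix as :: "nat list" and out b :: nat
  assume as: "set as \<subseteq> {2..<b}" and out: "out \<in> {2..<b}" and oas: "out \<notin> set as"
  define i tmp u B where "i = b" and "tmp = b + 1" and "u = b + 2" and "B = b + 3"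
  note regs = i_def tmp_def u_def B_def
  obtain cf where cf: "implements cf f (i # as) tmp B"
    by (rule implementableD[OF assms, of "i # as" B tmp]) (use as out in \<open>auto simp: regs\<close>)
  \<comment> \<open>Positivity is checked by counting \<open>u\<close> up from 1 for a guessed
    number of times and then testing equality with \<open>tmp\<close>.\<close>
  define positive where "positive = Seq (Set_to u 1) (Seq (Star (Inc u)) (Test u tmp))"
  define body where "body = Seq cf (Seq positive (Inc i))"
  define c where "c = Seq (Set_to i 0) (Seq (Star body)
     (Seq cf (Seq (Set_to u 0) (Seq (Test tmp u) (Copy out i)))))"
  have as': "set as \<subseteq> {..<b}" using as by auto
  have eq_as: "map \<tau> as = map \<sigma> as" if "frame b {} \<sigma> \<tau>" for \<sigma> \<tau>
    using frame_map[OF that as'] by simp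
  have fr: "frame b {} \<sigma> \<tau>" if "frame B {r} \<sigma> \<tau>" "b \<le> r" for \<sigma> \<tau> r
    using that by (auto simp: frame_def regs)
  have positive: "(\<sigma>, \<sigma>') \<in> prog_sem positive \<longleftrightarrow> \<sigma>' = \<sigma>(u := \<sigma> tmp) \<and> 0 < \<sigma> tmp" for \<sigma> \<sigma>'
  proof
    assume "(\<sigma>, \<sigma>') \<in> prog_sem positive"
    then show "\<sigma>' = \<sigma>(u := \<sigma> tmp) \<and> 0 < \<sigma> tmp"
      by (auto simp: positive_def star_inc[simplified] regs)
  next
    assume "\<sigma>' = \<sigma>(u := \<sigma> tmp) \<and> 0 < \<sigma> tmp"
    \<comment> \<open>Starting at 1, it takes \<open>\<sigma> tmp - 1\<close> increments; the
      subtraction is exact because \<open>\<sigma> tmp\<close> is positive.\<close>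
    then show "(\<sigma>, \<sigma>') \<in> prog_sem positive"
      unfolding positive_def prog_sem.simps
      by (intro relcompI[where b = "\<sigma>(u := 1)"] relcompI[where b = "\<sigma>(u := \<sigma> tmp)"])
        (auto simp: star_inc[simplified] regs intro!: exI[of _ "\<sigma> tmp - 1"])
  qed
  have iter: "frame b {} \<sigma> \<sigma>' \<and> \<sigma>' i = Suc (\<sigma> i) \<and> (\<exists>y. rec_eval f (\<sigma> i # map \<sigma> as) (Suc y))"
    if sem: "(\<sigma>, \<sigma>') \<in> prog_sem body" for \<sigma> \<sigma>'
  proof -
    obtain \<tau> where \<tau>: "(\<sigma>, \<tau>) \<in> prog_sem cf" "0 < \<tau> tmp" "\<sigma>' = \<tau>(u := \<tau> tmp, i := Suc (\<tau> i))"
      using sem by (auto simp: body_def positive regs)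
    note s = implements_sound[OF cf \<tau>(1)]
    have "frame b {} \<sigma> \<sigma>'" unfolding \<tau>(3) by (intro frame_upd fr[OF s(1)]) (auto simp: regs)
    moreover have "\<tau> i = \<sigma> i" using s(1) by (auto simp: frame_def regs)
    moreover obtain y where "\<tau> tmp = Suc y" using \<tau>(2) gr0_implies_Suc by blast
    ultimately show ?thesis using s(2) \<tau>(3) by (auto simp: regs)
  qed
  have loop: "frame b {} \<sigma> \<sigma>' \<and> (\<forall>m<\<sigma>' i. \<exists>y. rec_eval f (m # map \<sigma> as) (Suc y))"
    if sem: "(\<sigma>, \<sigma>') \<in> (prog_sem body)\<^sup>*" and start: "\<sigma> i = 0" for \<sigma> \<sigma>'
    using sem
  proof (induction rule: rtrancl_induct)
    case base then show ?case using start by simp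
  next
    case (step \<tau> \<tau>')
    from step.IH have fr\<tau>: "frame b {} \<sigma> \<tau>"
      and ev: "\<forall>m<\<tau> i. \<exists>y. rec_eval f (m # map \<sigma> as) (Suc y)" by auto
    have s: "frame b {} \<tau> \<tau>'" "\<tau>' i = Suc (\<tau> i)" "\<exists>y. rec_eval f (\<tau> i # map \<tau> as) (Suc y)"
      using iter[OF step.hyps(2)] by auto
    then show ?case using frame_trans[OF fr\<tau> s(1)] ev eq_as[OF fr\<tau>] by (auto simp: less_Suc_eq)
  qed
  have loop_complete: "\<exists>\<sigma>'. (\<sigma>, \<sigma>') \<in> (prog_sem body)\<^sup>* \<and> frame b {} \<sigma> \<sigma>' \<and> \<sigma>' i = n"
    if "\<forall>m<n. \<exists>y. rec_eval f (m # map \<sigma> as) (Suc y)" and start: "\<sigma> i = 0" for \<sigma> n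
    using that(1)
  proof (induction n)
    case 0
    then show ?case using start by (intro exI[of _ \<sigma>]) simp
  next
    case (Suc n)
    obtain y where y: "rec_eval f (n # map \<sigma> as) (Suc y)" using Suc.prems by blast
    obtain \<tau> where \<tau>: "(\<sigma>, \<tau>) \<in> (prog_sem body)\<^sup>*" "frame b {} \<sigma> \<tau>" "\<tau> i = n"
      using Suc.IH Suc.prems by auto
    obtain \<tau>' where \<tau>': "(\<tau>, \<tau>') \<in> prog_sem cf" "frame B {tmp} \<tau> \<tau>'" "\<tau>' tmp = Suc y"
      using implements_complete[OF cf, of \<tau> "Suc y"] y \<tau>(3) eq_as[OF \<tau>(2)] by auto
    define \<sigma>' where "\<sigma>' = \<tau>'(u := \<tau>' tmp, i := Suc (\<tau>' i))"
    have "(\<tau>'(u := \<tau>' tmp), \<sigma>') \<in> prog_sem (Inc i)" by (auto simp: \<sigma>'_def regs)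
    then have "(\<tau>, \<sigma>') \<in> prog_sem body"
      using \<tau>'(1,3) by (auto simp: body_def positive intro!: relcompI)
    moreover have "frame b {} \<tau> \<sigma>'"
      unfolding \<sigma>'_def by (intro frame_upd fr[OF \<tau>'(2)]) (auto simp: regs)
    moreover have "\<sigma>' i = Suc n"
      using \<tau>'(2) \<tau>(3) by (auto simp: \<sigma>'_def regs frame_def)
    ultimately show ?case
      using rtrancl_into_rtrancl[OF \<tau>(1)] frame_trans[OF \<tau>(2)] by blast
  qed
  have "implements c (Mn f) as out b"
  proof (rule implementsI)
    show "prog_ok c" using cf out by (auto simp: c_def body_def positive_def regs implements_ok)
  next
    fix \<sigma> \<sigma>' assume "(\<sigma>, \<sigma>') \<in> prog_sem c"
    then obtain \<tau> \<tau>' where \<tau>: "(\<sigma>(i := 0), \<tau>) \<in> (prog_sem body)\<^sup>*" "(\<tau>, \<tau>') \<in> prog_sem cf"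
      "\<tau>' tmp = 0" "\<sigma>' = \<tau>'(u := 0, out := \<tau>' i)"
      using out by (auto simp: c_def regs)
    have fr0: "frame b {} \<sigma> (\<sigma>(i := 0))" by (auto simp: frame_def regs)
    from loop[OF \<tau>(1)] have fr1: "frame b {} (\<sigma>(i := 0)) \<tau>"
      and ev: "\<forall>m<\<tau> i. \<exists>y. rec_eval f (m # map (\<sigma>(i := 0)) as) (Suc y)" by (auto simp: fun_upd_def)
    note s = implements_sound[OF cf \<tau>(2)]
    have fr2: "frame b {} \<sigma> \<tau>" using frame_trans[OF fr0 fr1] .
    have fr3: "frame b {} \<sigma> \<tau>'" using frame_trans[OF fr2 fr[OF s(1)]] by (simp add: regs)
    have "\<tau>' i = \<tau> i" using s(1) by (auto simp: frame_def regs)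
    moreover have "rec_eval (Mn f) (map \<sigma> as) (\<tau> i)"
      by (rule ev_mn) (use ev s(2) \<tau>(3) eq_as[OF fr0] eq_as[OF fr2] in auto)
    moreover have "frame b {out} \<sigma> \<sigma>'"
      using fr3 unfolding \<tau>(4) by (auto simp: frame_def regs)
    ultimately show "frame b {out} \<sigma> \<sigma>' \<and> rec_eval (Mn f) (map \<sigma> as) (\<sigma>' out)"
      using \<tau>(4) by simp
  next
    fix \<sigma> n assume Mn: "rec_eval (Mn f) (map \<sigma> as) n"
    have ev: "rec_eval f (n # map \<sigma> as) 0" "\<forall>m<n. \<exists>y. rec_eval f (m # map \<sigma> as) (Suc y)"
      by (rule rec_eval_MnE[OF Mn]; assumption)+
    have fr0: "frame b {} \<sigma> (\<sigma>(i := 0))" by (auto simp: frame_def regs)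
    obtain \<tau> where \<tau>: "(\<sigma>(i := 0), \<tau>) \<in> (prog_sem body)\<^sup>*" "frame b {} (\<sigma>(i := 0)) \<tau>" "\<tau> i = n"
      using loop_complete[of n "\<sigma>(i := 0)"] ev(2) eq_as[OF fr0] by auto
    have fr2: "frame b {} \<sigma> \<tau>" using frame_trans[OF fr0 \<tau>(2)] .
    obtain \<tau>' where \<tau>': "(\<tau>, \<tau>') \<in> prog_sem cf" "frame B {tmp} \<tau> \<tau>'" "\<tau>' tmp = 0"
      using implements_complete[OF cf, of \<tau> 0] ev(1) \<tau>(3) eq_as[OF fr2] by auto
    have fr3: "frame b {} \<sigma> \<tau>'" using frame_trans[OF fr2 fr[OF \<tau>'(2)]] by (simp add: regs)
    have i: "\<tau>' i = n" using \<tau>'(2) \<tau>(3) by (auto simp: frame_def regs)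
    define \<sigma>' where "\<sigma>' = \<tau>'(u := 0, out := \<tau>' i)"
    have "(\<tau>'(u := 0), \<sigma>') \<in> prog_sem (Copy out i)" by (auto simp: \<sigma>'_def regs)
    moreover have "(\<tau>'(u := 0), \<tau>'(u := 0)) \<in> prog_sem (Test tmp u)"
      using \<tau>'(3) by (auto simp: regs)
    moreover have "(\<tau>', \<tau>'(u := 0)) \<in> prog_sem (Set_to u 0)" "(\<sigma>, \<sigma>(i := 0)) \<in> prog_sem (Set_to i 0)"
      by auto
    ultimately have "(\<sigma>, \<sigma>') \<in> prog_sem c"
      using \<tau>(1) \<tau>'(1) unfolding c_def prog_sem.simps(2,3) by blast
    moreover have "frame b {out} \<sigma> \<sigma>'" using fr3 by (auto simp: frame_def \<sigma>'_def regs)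
    moreover have "\<sigma>' out = n" using i by (simp add: \<sigma>'_def)
    ultimately show "\<exists>\<sigma>'. (\<sigma>, \<sigma>') \<in> prog_sem c \<and> frame b {out} \<sigma> \<sigma>' \<and> \<sigma>' out = n" by blast
  qed
  then show "\<exists>c. implements c (Mn f) as out b" ..
qed

lemma recf_implementable: "implementable p"
  by (induction p) (auto intro: implementable_Zero implementable_Succ implementable_Proj
      implementable_Comp implementable_Prim implementable_Mn)

subsection \<open>Rule systems and digit strings\<close>

type_synonym rule = "nat \<times> act \<times> nat"

definition rule_step :: "rule set \<Rightarrow> ((nat \<times> store) \<times> (nat \<times> store)) set" where
  "rule_step R = {((l, \<sigma>), (l', \<sigma>')) |l \<sigma> l' \<sigma>'. \<exists>\<alpha>. (l, \<alpha>, l') \<in> R \<and> (\<sigma>, \<sigma>') \<in> act_sem \<alpha>}"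

lemma rule_step_mono: "R \<subseteq> R' \<Longrightarrow> rule_step R \<subseteq> rule_step R'"
  unfolding rule_step_def by blast

lemma rule_run_mono:
  "(c, c') \<in> (rule_step R)\<^sup>* \<Longrightarrow> R \<subseteq> R' \<Longrightarrow> (c, c') \<in> (rule_step R')\<^sup>*"
  by (meson rtrancl_mono rule_step_mono subsetD)

text \<open>\<open>Good\<close> labels each control point with an assertion, in the manner of
  weakest preconditions. Pulling it back along a run carries information from the last configuration
  to the first.\<close>

definition back_closed :: "rule set \<Rightarrow> (nat \<Rightarrow> store \<Rightarrow> bool) \<Rightarrow> bool" where
  "back_closed R Good \<longleftrightarrow>
     (\<forall>(l, \<alpha>, l')\<in>R. \<forall>\<sigma> \<sigma>'. (\<sigma>, \<sigma>') \<in> act_sem \<alpha> \<longrightarrow> Good l' \<sigma>' \<longrightarrow> Good l \<sigma>)"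

lemma back_closed_rtrancl:
  assumes "back_closed R Good" "(c, c') \<in> (rule_step R)\<^sup>*" "case_prod Good c'"
  shows "case_prod Good c"
  using assms(2,3)
proof (induction rule: converse_rtrancl_induct)
  case (step c c')
  then show ?case using assms(1) unfolding rule_step_def back_closed_def by fast
qed

lemma back_closed_cong:
  assumes "back_closed R Good" "\<And>l \<alpha> l'. (l, \<alpha>, l') \<in> R \<Longrightarrow> Good' l = Good l \<and> Good' l' = Good l'"
  shows "back_closed R Good'"
  using assms unfolding back_closed_def by fastforce

text \<open>The last conjunct expresses soundness: every labelling of the control points outside the
  fresh range \<open>{n..<n'}\<close> that is a correct pre/postcondition pair for \<open>p\<close> extends to one that is
  preserved backwards by all rules. This form also covers the case \<open>a = b\<close> of loop bodies.\<close>

definition compiles :: "prog \<Rightarrow> nat \<Rightarrow> nat \<Rightarrow> nat \<Rightarrow> rule list \<Rightarrow> nat \<Rightarrow> bool" where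
  "compiles p a b n rs n' \<longleftrightarrow> n \<le> n' \<and>
     (\<forall>(l, \<alpha>, l')\<in>set rs. act_ok \<alpha> \<and> l < n' \<and> l' < n') \<and>
     (\<forall>\<sigma> \<sigma>'. (\<sigma>, \<sigma>') \<in> prog_sem p \<longrightarrow> ((a, \<sigma>), (b, \<sigma>')) \<in> (rule_step (set rs))\<^sup>*) \<and>
     (\<forall>Good. (\<forall>\<sigma> \<sigma>'. (\<sigma>, \<sigma>') \<in> prog_sem p \<longrightarrow> Good b \<sigma>' \<longrightarrow> Good a \<sigma>) \<longrightarrow>
        (\<exists>Good'. (\<forall>l. l \<notin> {n..<n'} \<longrightarrow> Good' l = Good l) \<and> back_closed (set rs) Good'))"

lemma compilesD:
  assumes "compiles p a b n rs n'"
  shows "n \<le> n'"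
    and "\<And>l \<alpha> l'. (l, \<alpha>, l') \<in> set rs \<Longrightarrow> act_ok \<alpha> \<and> l < n' \<and> l' < n'"
    and "\<And>\<sigma> \<sigma>'. (\<sigma>, \<sigma>') \<in> prog_sem p \<Longrightarrow> ((a, \<sigma>), (b, \<sigma>')) \<in> (rule_step (set rs))\<^sup>*"
  using assms unfolding compiles_def by auto

lemma compiles_extend:
  assumes "compiles p a b n rs n'"
    and "\<forall>\<sigma> \<sigma>'. (\<sigma>, \<sigma>') \<in> prog_sem p \<longrightarrow> Good b \<sigma>' \<longrightarrow> Good a \<sigma>"
  shows "\<exists>Good'. (\<forall>l. l \<notin> {n..<n'} \<longrightarrow> Good' l = Good l) \<and> back_closed (set rs) Good'"
  using assms(1)[unfolded compiles_def, THEN conjunct2, THEN conjunct2, THEN conjunct2] assms(2)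
  by (elim allE[of _ Good] impE)

text \<open>Control points are handed out consecutively from \<open>n\<close> on, so different parts
  of a program have disjoint internal points and their labellings can be extended one after the
  other.\<close>

lemma compiles_exists:
  assumes "prog_ok p" "a < n" "b < n"
  shows "\<exists>rs n'. compiles p a b n rs n'"
  using assms
proof (induction p arbitrary: a b n)
  case (Act \<alpha>)
  have "compiles (Act \<alpha>) a b n [(a, \<alpha>, b)] n"
    unfolding compiles_def
  proof (intro conjI allI impI)
    fix \<sigma> \<sigma>' assume "(\<sigma>, \<sigma>') \<in> prog_sem (Act \<alpha>)"
    then show "((a, \<sigma>), b, \<sigma>') \<in> (rule_step (set [(a, \<alpha>, b)]))\<^sup>*"
      by (intro r_into_rtrancl) (simp add: rule_step_def)
  next
    fix Good :: "nat \<Rightarrow> store \<Rightarrow> bool"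
    assume "\<forall>\<sigma> \<sigma>'. (\<sigma>, \<sigma>') \<in> prog_sem (Act \<alpha>) \<longrightarrow> Good b \<sigma>' \<longrightarrow> Good a \<sigma>"
    then show "\<exists>Good'. (\<forall>l. l \<notin> {n..<n} \<longrightarrow> Good' l = Good l) \<and> back_closed (set [(a, \<alpha>, b)]) Good'"
      by (intro exI[of _ Good]) (simp add: back_closed_def)
  qed (use Act in auto)
  then show ?case by blast
next
  case (Seq p q)
  from Seq.prems Seq.IH(1)[of a "Suc n" n] obtain rs m where p: "compiles p a n (Suc n) rs m"
    by auto
  note p' = compilesD[OF p]
  from Seq.prems Seq.IH(2)[of n m b] p'(1) obtain rs' m' where q: "compiles q n b m rs' m'"
    by auto
  note q' = compilesD[OF q]
  have "compiles (Seq p q) a b n (rs @ rs') m'"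
    unfolding compiles_def
  proof (intro conjI allI impI)
    show "n \<le> m'" using p'(1) q'(1) by simp
    show "\<forall>(l, \<alpha>, l')\<in>set (rs @ rs'). act_ok \<alpha> \<and> l < m' \<and> l' < m'"
      using p'(2) q'(1,2) by fastforce
  next
    fix \<sigma> \<sigma>' assume "(\<sigma>, \<sigma>') \<in> prog_sem (Seq p q)"
    then obtain \<tau> where "(\<sigma>, \<tau>) \<in> prog_sem p" "(\<tau>, \<sigma>') \<in> prog_sem q" by auto
    note runs = p'(3)[OF this(1)] q'(3)[OF this(2)]
    have "((a, \<sigma>), (n, \<tau>)) \<in> (rule_step (set (rs @ rs')))\<^sup>*"
      by (rule rule_run_mono[OF runs(1)]) simp
    moreover have "((n, \<tau>), (b, \<sigma>')) \<in> (rule_step (set (rs @ rs')))\<^sup>*"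
      by (rule rule_run_mono[OF runs(2)]) simp
    ultimately show "((a, \<sigma>), b, \<sigma>') \<in> (rule_step (set (rs @ rs')))\<^sup>*"
      by (rule rtrancl_trans)
  next
    fix Good :: "nat \<Rightarrow> store \<Rightarrow> bool"
    assume good: "\<forall>\<sigma> \<sigma>'. (\<sigma>, \<sigma>') \<in> prog_sem (Seq p q) \<longrightarrow> Good b \<sigma>' \<longrightarrow> Good a \<sigma>"
    \<comment> \<open>The new point between the two halves gets the weakest precondition of
      \<open>q\<close>.\<close>
    define G where "G = Good(n := \<lambda>\<sigma>. \<exists>\<sigma>'. (\<sigma>, \<sigma>') \<in> prog_sem q \<and> Good b \<sigma>')"
    have pre: "\<forall>\<sigma> \<sigma>'. (\<sigma>, \<sigma>') \<in> prog_sem p \<longrightarrow> G n \<sigma>' \<longrightarrow> G a \<sigma>"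
      using good Seq.prems by (auto simp: G_def)
    obtain G1 where G1: "\<forall>l. l \<notin> {Suc n..<m} \<longrightarrow> G1 l = G l" "back_closed (set rs) G1"
      using compiles_extend[OF p, of G, OF pre] by (elim exE conjE)
    have pre': "\<forall>\<sigma> \<sigma>'. (\<sigma>, \<sigma>') \<in> prog_sem q \<longrightarrow> G1 b \<sigma>' \<longrightarrow> G1 n \<sigma>"
      using Seq.prems G1(1)[rule_format, of n] G1(1)[rule_format, of b] by (auto simp: G_def)
    obtain G2 where G2: "\<forall>l. l \<notin> {m..<m'} \<longrightarrow> G2 l = G1 l" "back_closed (set rs') G2"
      using compiles_extend[OF q, of G1, OF pre'] by (elim exE conjE)
    \<comment> \<open>The rules of \<open>p\<close> mention only points below \<open>m\<close>,
      where the second extension changes no label.\<close>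
    have "back_closed (set rs) G2"
      by (rule back_closed_cong[OF G1(2)]) (use G2(1) p'(2) in force)
    then have "back_closed (set (rs @ rs')) G2"
      using G2(2) by (auto simp: back_closed_def)
    moreover have "G2 l = Good l" if "l \<notin> {n..<m'}" for l
      using that G1(1)[rule_format, of l] G2(1)[rule_format, of l] p'(1) q'(1) by (auto simp: G_def)
    ultimately show "\<exists>Good'. (\<forall>l. l \<notin> {n..<m'} \<longrightarrow> Good' l = Good l) \<and>
        back_closed (set (rs @ rs')) Good'" by blast
  qed
  then show ?case by blast
next
  case (Star p)
  from Star.prems Star.IH[of n "Suc n" n] obtain rs m where p: "compiles p n n (Suc n) rs m"
    by auto
  note p' = compilesD[OF p]
  \<comment> \<open>A fresh loop head with idle rules for entry and exit keeps the iterations apart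
    from \<open>a\<close> and \<open>b\<close>, where other rules may start or end.\<close>
  define rs' where "rs' = (a, Eq 2 2, n) # (n, Eq 2 2, b) # rs"
  have "compiles (Star p) a b n rs' m"
    unfolding compiles_def
  proof (intro conjI allI impI)
    show "n \<le> m" using p'(1) by simp
    show "\<forall>(l, \<alpha>, l')\<in>set rs'. act_ok \<alpha> \<and> l < m \<and> l' < m"
      using p'(1,2) Star.prems by (fastforce simp: rs'_def)
  next
    fix \<sigma> \<sigma>' assume "(\<sigma>, \<sigma>') \<in> prog_sem (Star p)"
    then have "(\<sigma>, \<sigma>') \<in> (prog_sem p)\<^sup>*" by simp
    then have "((n, \<sigma>), (n, \<sigma>')) \<in> (rule_step (set rs))\<^sup>*"
    proof (induction rule: rtrancl_induct)
      case (step \<tau> \<tau>')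
      then show ?case using p'(3)[of \<tau> \<tau>'] by (meson rtrancl_trans)
    qed simp
    then have "((n, \<sigma>), (n, \<sigma>')) \<in> (rule_step (set rs'))\<^sup>*"
      by (rule rule_run_mono) (auto simp: rs'_def)
    moreover have "((a, \<sigma>), (n, \<sigma>)) \<in> rule_step (set rs')" "((n, \<sigma>'), (b, \<sigma>')) \<in> rule_step (set rs')"
      by (auto simp: rule_step_def rs'_def intro!: exI[of _ "Eq 2 2"])
    ultimately show "((a, \<sigma>), b, \<sigma>') \<in> (rule_step (set rs'))\<^sup>*"
      by (meson converse_rtrancl_into_rtrancl rtrancl_into_rtrancl)
  next
    fix Good :: "nat \<Rightarrow> store \<Rightarrow> bool"
    assume good: "\<forall>\<sigma> \<sigma>'. (\<sigma>, \<sigma>') \<in> prog_sem (Star p) \<longrightarrow> Good b \<sigma>' \<longrightarrow> Good a \<sigma>"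
    \<comment> \<open>The label of the loop head allows any number of further iterations, so the
      body preserves it backwards.\<close>
    define G where "G = Good(n := \<lambda>\<sigma>. \<exists>\<sigma>'. (\<sigma>, \<sigma>') \<in> (prog_sem p)\<^sup>* \<and> Good b \<sigma>')"
    have pre: "\<forall>\<sigma> \<sigma>'. (\<sigma>, \<sigma>') \<in> prog_sem p \<longrightarrow> G n \<sigma>' \<longrightarrow> G n \<sigma>"
      by (auto simp: G_def intro: converse_rtrancl_into_rtrancl)
    obtain G1 where G1: "\<forall>l. l \<notin> {Suc n..<m} \<longrightarrow> G1 l = G l" "back_closed (set rs) G1"
      using compiles_extend[OF p, of G, OF pre] by (elim exE conjE)
    have eqs: "G1 n = G n" "G1 a = Good a" "G1 b = Good b"
      using G1(1)[rule_format, of n] G1(1)[rule_format, of a] G1(1)[rule_format, of b] Star.prems by (auto simp: G_def)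
    have "back_closed (set rs') G1"
      using G1(2) good by (auto simp: back_closed_def rs'_def eqs) (auto simp: G_def)
    moreover have "G1 l = Good l" if "l \<notin> {n..<m}" for l
      using that G1(1)[rule_format, of l] p'(1) by (auto simp: G_def)
    ultimately show "\<exists>Good'. (\<forall>l. l \<notin> {n..<m} \<longrightarrow> Good' l = Good l) \<and> back_closed (set rs') Good'"
      by blast
  qed
  then show ?case by blast
qed

text \<open>The idle rule at the final control point lets accepting runs be arbitrarily long.\<close>

lemma rules_exist:
  assumes "prog_ok p"
  obtains rs where "(1, Eq 2 2, 1) \<in> set rs" "\<forall>(l, \<alpha>, l')\<in>set rs. act_ok \<alpha>"
    "\<And>\<sigma>. (\<exists>\<sigma>'. ((0, \<sigma>), (1, \<sigma>')) \<in> (rule_step (set rs))\<^sup>*) \<longleftrightarrow> (\<exists>\<sigma>'. (\<sigma>, \<sigma>') \<in> prog_sem p)"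
proof -
  obtain rs n where c: "compiles p 0 1 2 rs n"
    using compiles_exists[OF assms, of 0 2 1] by auto
  note c' = compilesD[OF c]
  let ?rs = "(1, Eq 2 2, 1) # rs"
  \<comment> \<open>Apart from point 0 every label is trivially true. Thus a run from 0 to 1 carries
    goodness back to 0, where it says that the program has a run.\<close>
  define Good where "Good l = (\<lambda>\<sigma>. l = 0 \<longrightarrow> (\<exists>\<sigma>'. (\<sigma>, \<sigma>') \<in> prog_sem p))" for l :: nat
  have pre: "\<forall>\<sigma> \<sigma>'. (\<sigma>, \<sigma>') \<in> prog_sem p \<longrightarrow> Good 1 \<sigma>' \<longrightarrow> Good 0 \<sigma>"
      by (auto simp: Good_def)
  obtain G where G: "\<forall>l. l \<notin> {2..<n} \<longrightarrow> G l = Good l" "back_closed (set rs) G"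
    using compiles_extend[OF c, of Good, OF pre] by (elim exE conjE)
  have "back_closed (set ?rs) G"
    using G(2) by (auto simp: back_closed_def)
  note bc = back_closed_rtrancl[OF this]
  show ?thesis
  proof (rule that[of ?rs])
    fix \<sigma>
    show "(\<exists>\<sigma>'. ((0, \<sigma>), (1, \<sigma>')) \<in> (rule_step (set ?rs))\<^sup>*) \<longleftrightarrow> (\<exists>\<sigma>'. (\<sigma>, \<sigma>') \<in> prog_sem p)"
    proof
      assume "\<exists>\<sigma>'. ((0, \<sigma>), (1, \<sigma>')) \<in> (rule_step (set ?rs))\<^sup>*"
      then obtain \<sigma>' where "((0, \<sigma>), (1, \<sigma>')) \<in> (rule_step (set ?rs))\<^sup>*" ..
      from bc[OF this] have "G 0 \<sigma>" using G(1)[rule_format, of 1] by (simp add: Good_def)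
      then show "\<exists>\<sigma>'. (\<sigma>, \<sigma>') \<in> prog_sem p" using G(1)[rule_format, of 0] by (simp add: Good_def)
    next
      assume "\<exists>\<sigma>'. (\<sigma>, \<sigma>') \<in> prog_sem p"
      then obtain \<sigma>' where "((0, \<sigma>), (1, \<sigma>')) \<in> (rule_step (set rs))\<^sup>*" using c'(3) by blast
      then have "((0, \<sigma>), (1, \<sigma>')) \<in> (rule_step (set ?rs))\<^sup>*"
        by (rule rule_run_mono) auto
      then show "\<exists>\<sigma>'. ((0, \<sigma>), (1, \<sigma>')) \<in> (rule_step (set ?rs))\<^sup>*" by blast
    qed
  next
    show "\<forall>(l, \<alpha>, l')\<in>set ?rs. act_ok \<alpha>" using c'(2) by fastforce
  qed simp
qed

section \<open>Cost of a digit string and accepting words\<close>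

fun penalty :: "rule \<Rightarrow> (nat \<Rightarrow> int) \<Rightarrow> int" where
  "penalty (l, Aff i m j c, l') x = (x 1 - int l)\<^sup>2"
| "penalty (l, Eq i j, l') x = (x 1 - int l)\<^sup>2 + (x i - x j)\<^sup>2"

text \<open>The rule is carried out even if its guard fails; only \<open>penalty\<close> records the
  failure. Hence a step is an affine map on all integer vectors, without case distinction.\<close>

fun update :: "rule \<Rightarrow> (nat \<Rightarrow> int) \<Rightarrow> nat \<Rightarrow> int" where
  "update (l, Aff i m j c, l') x = x(i := int m * x j + int c, 1 := int l')"
| "update (l, Eq i j, l') x = x(1 := int l')"

text \<open>A digit string selects a sequence of rules in unary: the digit 0 advances the selector \<open>s\<close>,
  any other digit fires the selected rule and resets the selector.\<close>

primrec cost :: "rule list \<Rightarrow> nat list \<Rightarrow> nat \<Rightarrow> (nat \<Rightarrow> int) \<Rightarrow> int" where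
  "cost rs [] s x = (x 1 - 1)\<^sup>2"
| "cost rs (d # ds) s x = (if d = 0 then cost rs ds (Suc s mod length rs) x
     else penalty (rs ! s) x + cost rs ds 0 (update (rs ! s) x))"

definition config :: "nat \<Rightarrow> store \<Rightarrow> nat \<Rightarrow> int" where
  "config l \<sigma> i = (if i = 0 then 1 else if i = 1 then int l else int (\<sigma> i))"

lemma penalty_nonneg: "0 \<le> penalty r x"
  by (cases "(r, x)" rule: penalty.cases) auto

lemma cost_nonneg: "0 \<le> cost rs ds s x"
  by (induction ds arbitrary: s x) (auto intro: add_nonneg_nonneg penalty_nonneg)

lemma rule_step_config:
  assumes "(\<sigma>, \<sigma>') \<in> act_sem \<alpha>" "act_ok \<alpha>"
  shows "penalty (l, \<alpha>, l') (config l \<sigma>) = 0" "update (l, \<alpha>, l') (config l \<sigma>) = config l' \<sigma>'"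
  using assms by (cases \<alpha>; auto simp: config_def fun_eq_iff)+

lemma penalty_eq_0:
  assumes "penalty (l', \<alpha>, l'') (config l \<sigma>) = 0" "act_ok \<alpha>"
  shows "l' = l" "\<exists>\<sigma>'. (\<sigma>, \<sigma>') \<in> act_sem \<alpha>"
  using assms by (cases \<alpha>; auto simp: config_def add_nonneg_eq_0_iff)+

text \<open>A sum of squares vanishes only if each square does. So every fired rule was applicable,
  the final control point is 1, and the digits 0 make no step.\<close>

lemma cost_0_imp_run:
  assumes "cost rs ds s (config l \<sigma>) = 0" "s < length rs"
    and "\<forall>(l, \<alpha>, l')\<in>set rs. act_ok \<alpha>"
  shows "\<exists>\<sigma>'. ((l, \<sigma>), (1, \<sigma>')) \<in> (rule_step (set rs))\<^sup>*"
  using assms(1,2)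
proof (induction ds arbitrary: s l \<sigma>)
  case Nil
  then show ?case by (auto simp: config_def)
next
  case (Cons d ds)
  show ?case
  proof (cases "d = 0")
    case True
    show ?thesis
      by (rule Cons.IH[of "Suc s mod length rs"]) (use Cons.prems True in \<open>auto intro!: mod_less_divisor\<close>)
  next
    case False
    obtain k \<alpha> l' where r: "rs ! s = (k, \<alpha>, l')" by (cases "rs ! s") auto
    have mem: "(k, \<alpha>, l') \<in> set rs" using r Cons.prems(2) by (metis nth_mem)
    have ok: "act_ok \<alpha>" using assms(3) mem by auto
    have z: "penalty (k, \<alpha>, l') (config l \<sigma>) = 0"
      "cost rs ds 0 (update (k, \<alpha>, l') (config l \<sigma>)) = 0"
      using Cons.prems(1) False r penalty_nonneg[of "(k, \<alpha>, l')" "config l \<sigma>"]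
        cost_nonneg[of rs ds 0 "update (k, \<alpha>, l') (config l \<sigma>)"] by auto
    from penalty_eq_0[OF z(1) ok] obtain \<tau> where \<tau>: "k = l" "(\<sigma>, \<tau>) \<in> act_sem \<alpha>" by auto
    have "cost rs ds 0 (config l' \<tau>) = 0"
      using z(2) rule_step_config(2)[OF \<tau>(2) ok] \<tau>(1) by simp
    then obtain \<sigma>' where \<sigma>': "((l', \<tau>), (1, \<sigma>')) \<in> (rule_step (set rs))\<^sup>*"
      using Cons.IH[of 0 l' \<tau>] Cons.prems(2) by fastforce
    have "((l, \<sigma>), (l', \<tau>)) \<in> rule_step (set rs)"
      using mem \<tau> by (auto simp: rule_step_def)
    then show ?thesis using \<sigma>' by (meson converse_rtrancl_into_rtrancl)
  qed
qed

lemma cost_skip: "s + t < length rs \<Longrightarrow> cost rs (replicate t 0 @ ds) s x = cost rs ds (s + t) x"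
  by (induction t arbitrary: s) auto

text \<open>The digits 0 and 1 exist in every base. As \<open>digits\<close> lists the least
  significant digit first, the last entry is the leading digit and must not be 0.\<close>

definition accepting_word :: "rule list \<Rightarrow> (nat \<Rightarrow> int) \<Rightarrow> nat list \<Rightarrow> bool" where
  "accepting_word rs x ds \<longleftrightarrow>
     set ds \<subseteq> {0, 1} \<and> (ds \<noteq> [] \<longrightarrow> last ds = 1) \<and> cost rs ds 0 x = 0"

text \<open>If the rule stands at position \<open>t\<close>, the prefix of \<open>t\<close> zeros
  and a 1 selects and fires it. Prepending keeps the last digit, or makes it 1 if the word was
  empty.\<close>

lemma accepting_word_step:
  assumes "accepting_word rs (config l' \<sigma>') ds" "(l, \<alpha>, l') \<in> set rs"
    "(\<sigma>, \<sigma>') \<in> act_sem \<alpha>" "act_ok \<alpha>"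
  shows "\<exists>ds'. accepting_word rs (config l \<sigma>) ds' \<and> length ds < length ds'"
proof -
  obtain t where t: "t < length rs" "rs ! t = (l, \<alpha>, l')" using assms(2) by (metis in_set_conv_nth)
  have "cost rs (replicate t 0 @ 1 # ds) 0 (config l \<sigma>) = 0"
    using assms(1) t rule_step_config[OF assms(3,4)] by (simp add: cost_skip accepting_word_def)
  then have "accepting_word rs (config l \<sigma>) (replicate t 0 @ 1 # ds)"
    using assms(1) by (auto simp: accepting_word_def)
  then show ?thesis by (intro exI conjI) auto
qed

text \<open>Firing the idle rule at the final control point prolongs the word at will. The arbitrary
  bound \<open>N\<close> later yields accepting words of arbitrarily large numbers.\<close>

lemma run_imp_accepting_word:
  assumes "((l, \<sigma>), (1, \<sigma>')) \<in> (rule_step (set rs))\<^sup>*" "(1, Eq 2 2, 1) \<in> set rs"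
    and "\<forall>(l, \<alpha>, l')\<in>set rs. act_ok \<alpha>"
  shows "\<exists>ds. accepting_word rs (config l \<sigma>) ds \<and> N \<le> length ds"
  using assms(1)
proof (induction rule: converse_rtrancl_induct2)
  case refl
  show ?case
  proof (induction N)
    case 0
    show ?case by (intro exI[of _ "[]"]) (simp add: accepting_word_def config_def)
  next
    case (Suc N)
    then obtain ds where ds: "accepting_word rs (config 1 \<sigma>') ds" "N \<le> length ds" by blast
    have "(\<sigma>', \<sigma>') \<in> act_sem (Eq 2 2)" "act_ok (Eq 2 2)" by auto
    from accepting_word_step[OF ds(1) assms(2) this] show ?case using ds(2) by auto
  qed
next
  case (step l \<sigma> l' \<tau>)
  then obtain \<alpha> where \<alpha>: "(l, \<alpha>, l') \<in> set rs" "(\<sigma>, \<tau>) \<in> act_sem \<alpha>" by (auto simp: rule_step_def)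
  from step.IH obtain ds where ds: "accepting_word rs (config l' \<tau>) ds" "N \<le> length ds" by blast
  have "act_ok \<alpha>" using assms(3) \<alpha>(1) by auto
  from accepting_word_step[OF ds(1) \<alpha> this] show ?case using ds(2) by auto
qed

subsection \<open>Quadratic forms and linear representations\<close>

definition lin :: "nat \<Rightarrow> (nat \<Rightarrow> int) \<Rightarrow> (nat \<Rightarrow> int) \<Rightarrow> int" where
  "lin d p x = (\<Sum>i<d. p i * x i)"

definition quad :: "nat \<Rightarrow> (nat \<Rightarrow> nat \<Rightarrow> int) \<Rightarrow> (nat \<Rightarrow> int) \<Rightarrow> int" where
  "quad d q x = (\<Sum>i<d. \<Sum>j<d. q i j * (x i * x j))"

definition coord :: "nat \<Rightarrow> nat \<Rightarrow> int" where
  "coord a i = (if i = a then 1 else 0)"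

lemma lin_coord: "a < d \<Longrightarrow> lin d (coord a) x = x a"
  by (simp add: lin_def coord_def if_distrib[of "\<lambda>u. u * _"] sum.delta cong: if_cong)

lemma lin_add: "lin d (\<lambda>i. p i + q i) x = lin d p x + lin d q x"
  by (simp add: lin_def distrib_right sum.distrib)

lemma lin_diff: "lin d (\<lambda>i. p i - q i) x = lin d p x - lin d q x"
  by (simp add: lin_def left_diff_distrib sum_subtractf)

lemma lin_scale: "lin d (\<lambda>i. c * p i) x = c * lin d p x"
  by (simp add: lin_def sum_distrib_left mult.assoc)

lemma quad_product: "quad d (\<lambda>i j. p i * q j) x = lin d p x * lin d q x"
  unfolding quad_def lin_def sum_product by (intro sum.cong refl) (simp add: algebra_simps)

lemma quad_add: "quad d (\<lambda>i j. p i j + q i j) x = quad d p x + quad d q x"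
  by (simp add: quad_def distrib_right sum.distrib)

lemma quad_scale: "quad d (\<lambda>i j. c * q i j) x = c * quad d q x"
  by (simp add: quad_def sum_distrib_left mult.assoc)

lemma quad_sum: "quad d (\<lambda>i j. \<Sum>a\<in>A. q a i j) x = (\<Sum>a\<in>A. quad d (q a) x)"
proof -
  have "quad d (\<lambda>i j. \<Sum>a\<in>A. q a i j) x = (\<Sum>i<d. \<Sum>j<d. \<Sum>a\<in>A. q a i j * (x i * x j))"
    by (simp add: quad_def sum_distrib_right)
  also have "\<dots> = (\<Sum>i<d. \<Sum>a\<in>A. \<Sum>j<d. q a i j * (x i * x j))"
    by (intro sum.cong refl sum.swap)
  also have "\<dots> = (\<Sum>a\<in>A. quad d (q a) x)"
    unfolding quad_def by (rule sum.swap)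
  finally show ?thesis .
qed

lemma quad_cong: "(\<And>i. i < d \<Longrightarrow> x i = y i) \<Longrightarrow> quad d q x = quad d q y"
  unfolding quad_def by (intro sum.cong refl) auto

text \<open>In matrix terms the new form is \<open>A^T c A\<close>. What matters is that it depends
  linearly on the coefficients \<open>c\<close>.\<close>

lemma quad_substitute:
  "quad d c (\<lambda>i. lin d (A i) x) =
   quad d (\<lambda>i j. \<Sum>i'<d. \<Sum>j'<d. c i' j' * (A i' i * A j' j)) x"
  by (simp add: quad_sum quad_scale quad_product) (simp add: quad_def)

fun act_below :: "nat \<Rightarrow> act \<Rightarrow> bool" where
  "act_below d (Aff i m j c) \<longleftrightarrow> i < d \<and> j < d"
| "act_below d (Eq i j) \<longleftrightarrow> i < d \<and> j < d"

lemma act_below_mono: "act_below d \<alpha> \<Longrightarrow> d \<le> d' \<Longrightarrow> act_below d' \<alpha>"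
  by (cases \<alpha>) auto

text \<open>The bound 5 makes room for the constant, the program counter and the three
  arguments.\<close>

lemma act_below_exists: "\<exists>d\<ge>5. \<forall>(l, \<alpha>, l')\<in>set rs. act_below d \<alpha>"
proof (induction rs)
  case (Cons r rs)
  obtain l \<alpha> l' where r: "r = (l, \<alpha>, l')" by (cases r) auto
  have "\<exists>e. act_below e \<alpha>"
  proof (cases \<alpha>)
    case (Aff i m j c)
    then show ?thesis by (intro exI[of _ "Suc (i + j)"]) simp
  next
    case (Eq i j)
    then show ?thesis by (intro exI[of _ "Suc (i + j)"]) simp
  qed
  then obtain e where e: "act_below e \<alpha>" ..
  from Cons.IH obtain d where d: "5 \<le> d" "\<forall>(l, \<alpha>, l')\<in>set rs. act_below d \<alpha>" by blast
  have "act_below (max d e) \<beta>" if "(k, \<beta>, k') \<in> set (r # rs)" for k \<beta> k'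
    using that d(2) e r by (auto intro: act_below_mono)
  then show ?case using d(1) by (intro exI[of _ "max d e"]) auto
qed (auto intro: exI[of _ 5])

fun penalty_form :: "rule \<Rightarrow> nat \<Rightarrow> nat \<Rightarrow> int" where
  "penalty_form (l, Aff i m j c, l') =
     (\<lambda>a b. (coord 1 a - int l * coord 0 a) * (coord 1 b - int l * coord 0 b))"
| "penalty_form (l, Eq i j, l') =
     (\<lambda>a b. (coord 1 a - int l * coord 0 a) * (coord 1 b - int l * coord 0 b) +
       (coord i a - coord j a) * (coord i b - coord j b))"

fun update_form :: "rule \<Rightarrow> nat \<Rightarrow> nat \<Rightarrow> int" where
  "update_form (l, Aff i m j c, l') a =
     (if a = 1 then (\<lambda>b. int l' * coord 0 b)
      else if a = i then (\<lambda>b. int m * coord j b + int c * coord 0 b) else coord a)"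
| "update_form (l, Eq i j, l') a = (if a = 1 then (\<lambda>b. int l' * coord 0 b) else coord a)"

lemma penalty_quad:
  assumes "act_below d \<alpha>" "2 \<le> d" "x 0 = 1"
  shows "penalty (l, \<alpha>, l') x = quad d (penalty_form (l, \<alpha>, l')) x"
  using assms
  by (cases \<alpha>) (simp_all add: quad_add quad_product lin_diff lin_scale lin_coord power2_eq_square
      del: One_nat_def)

text \<open>The coordinate \<open>x 0 = 1\<close> carries the additive constants and so turns affine
  maps into linear ones.\<close>

lemma update_lin:
  assumes "act_below d \<alpha>" "2 \<le> d" "x 0 = 1" "a < d"
  shows "update (l, \<alpha>, l') x a = lin d (update_form (l, \<alpha>, l') a) x"
  using assms
  by (cases \<alpha>) (simp_all add: lin_add lin_scale lin_coord del: One_nat_def)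

lemma update_0: "act_ok \<alpha> \<Longrightarrow> update (l, \<alpha>, l') x 0 = x 0"
  by (cases \<alpha>) auto

text \<open>For a fixed first digit these coefficients depend affinely on those for the remaining
  digits; regularity rests on this.\<close>

primrec cost_form :: "nat \<Rightarrow> rule list \<Rightarrow> nat list \<Rightarrow> nat \<Rightarrow> nat \<Rightarrow> nat \<Rightarrow> int" where
  "cost_form d rs [] s = (\<lambda>i j. (coord 1 i - coord 0 i) * (coord 1 j - coord 0 j))"
| "cost_form d rs (c # ds) s = (if c = 0 then cost_form d rs ds (Suc s mod length rs)
     else (\<lambda>i j. penalty_form (rs ! s) i j + (\<Sum>i'<d. \<Sum>j'<d. cost_form d rs ds 0 i' j' *
       (update_form (rs ! s) i' i * update_form (rs ! s) j' j))))"

text \<open>The condition \<open>x 0 = 1\<close> persists along the word because no admissible rule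
  writes to cell 0.\<close>

lemma cost_quad:
  assumes "\<forall>(l, \<alpha>, l')\<in>set rs. act_ok \<alpha>" "\<forall>(l, \<alpha>, l')\<in>set rs. act_below d \<alpha>"
    and "2 \<le> d" "x 0 = 1" "s < length rs"
  shows "cost rs ds s x = quad d (cost_form d rs ds s) x"
  using assms(4,5)
proof (induction ds arbitrary: s x)
  case Nil
  then show ?case using assms(3)
    by (simp add: quad_product lin_diff lin_coord power2_eq_square del: One_nat_def)
next
  case (Cons c ds)
  show ?case
  proof (cases "c = 0")
    case True
    have "Suc s mod length rs < length rs" using Cons.prems(2) by (intro mod_less_divisor) linarith
    with Cons.IH[of x "Suc s mod length rs"] Cons.prems(1) show ?thesis using True by simp
  next
    case False
    obtain l \<alpha> l' where r: "rs ! s = (l, \<alpha>, l')" by (cases "rs ! s") auto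
    have mem: "(l, \<alpha>, l') \<in> set rs" using r Cons.prems(2) by (metis nth_mem)
    have ok: "act_ok \<alpha>" and below: "act_below d \<alpha>" using assms(1,2) mem by auto
    have "0 < length rs" using Cons.prems(2) by linarith
    then have "cost rs ds 0 (update (rs ! s) x) = quad d (cost_form d rs ds 0) (update (rs ! s) x)"
      using Cons.IH[of "update (rs ! s) x" 0] update_0[OF ok] Cons.prems(1) r by simp
    also have "\<dots> = quad d (cost_form d rs ds 0) (\<lambda>i. lin d (update_form (rs ! s) i) x)"
      using update_lin[where x = x, OF below assms(3) Cons.prems(1)] r by (intro quad_cong) simp
    finally have rest: "cost rs ds 0 (update (rs ! s) x) =
        quad d (cost_form d rs ds 0) (\<lambda>i. lin d (update_form (rs ! s) i) x)" .
    show ?thesis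
      using False rest penalty_quad[where x = x, OF below assms(3) Cons.prems(1)] r
      by (simp add: quad_add quad_substitute)
  qed
qed

section \<open>Linear representations from linear recurrences\<close>

lemma sum_list_positions:
  fixes f :: "'a \<Rightarrow> real"
  assumes "distinct is"
  shows "(\<Sum>t<length is. f (is ! t)) = (\<Sum>a\<in>set is. f a)"
  using assms sum.reindex_bij_betw[OF bij_betw_nth[OF assms refl refl], of f] by simp

declare digits.simps [simp del]

lemma digits_0: "digits k 0 = []"
  by (simp add: digits.simps)

lemma digits_rec: "n \<noteq> 0 \<Longrightarrow> 2 \<le> k \<Longrightarrow> digits k n = n mod k # digits k (n div k)"
  by (simp add: digits.simps)

lemma digits_induct [case_names k 0 rec]:
  assumes "2 \<le> k" "P 0" "\<And>n. n \<noteq> 0 \<Longrightarrow> P (n div k) \<Longrightarrow> P n"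
  shows "P (n :: nat)"
proof (induction n rule: less_induct)
  case (less n)
  then show ?case using assms by (cases "n = 0") auto
qed

lemma digits_less:
  assumes "2 \<le> k"
  shows "c \<in> set (digits k n) \<Longrightarrow> c < k"
  by (induction n rule: digits_induct[OF assms]) (use assms in \<open>auto simp: digits_0 digits_rec\<close>)

text \<open>The row vector meets the matrices in the order of \<open>digits\<close>, so prepending a
  digit to a word means applying one more matrix to the column of values. The function
  \<open>h\<close> enters the row vector alone; all other data are shared.\<close>

lemma linrep_of_recurrence:
  fixes V :: "'a \<Rightarrow> nat list \<Rightarrow> int"
  assumes "2 \<le> k" "distinct is"
    and V: "\<forall>a\<in>set is. \<forall>c<k. \<forall>ds. V a (c # ds) = (\<Sum>b\<in>set is. M c a b * V b ds)"
  defines "L h \<equiv> (length is, map (\<lambda>a. int_alg (h a)) is, map (\<lambda>a. int_alg (V a [])) is,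
      map (\<lambda>c. map (\<lambda>a. map (\<lambda>b. int_alg (M c a b)) is) is) [0..<k])"
  shows "linrep_valid k (L h)"
    and "linrep_seq k (L h) n = of_int (\<Sum>a\<in>set is. h a * V a (digits k n))"
proof -
  show "linrep_valid k (L h)"
    by (auto simp: linrep_valid_def L_def alg_valid_int_alg)
  define r where "r = length is"
  define rM where "rM = map (map (map alg_val)) (map (\<lambda>c. map (\<lambda>a. map (\<lambda>b. int_alg (M c a b)) is) is) [0..<k])"
  have rM: "rM ! c ! i ! j = of_int (M c (is ! i) (is ! j))" if "c < k" "i < r" "j < r" for c i j
    using that by (simp add: rM_def r_def alg_val_int_alg)
  \<comment> \<open>Stated for every row vector \<open>u\<close>, since it changes along the
    word.\<close>
  have run: "(\<Sum>t<r. foldl (\<lambda>u c. vec_mat r u (rM ! c)) u ds ! t * of_int (V (is ! t) [])) =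
      (\<Sum>t<r. u ! t * of_int (V (is ! t) ds))" if "\<And>c. c \<in> set ds \<Longrightarrow> c < k" for u ds
    using that
  proof (induction ds arbitrary: u)
    case (Cons c ds)
    have c: "c < k" using Cons.prems by simp
    have "(\<Sum>t<r. foldl (\<lambda>u c. vec_mat r u (rM ! c)) u (c # ds) ! t * of_int (V (is ! t) [])) =
        (\<Sum>t<r. vec_mat r u (rM ! c) ! t * of_int (V (is ! t) ds))"
      using Cons.IH[of "vec_mat r u (rM ! c)"] Cons.prems by simp
    also have "\<dots> = (\<Sum>t<r. \<Sum>i<r. u ! i * (of_int (M c (is ! i) (is ! t)) * of_int (V (is ! t) ds)))"
      by (intro sum.cong refl) (simp add: vec_mat_def sum_distrib_right rM[OF c] mult.assoc)
    also have "\<dots> = (\<Sum>i<r. u ! i * (\<Sum>t<r. of_int (M c (is ! i) (is ! t)) * of_int (V (is ! t) ds)))"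
      unfolding sum_distrib_left by (rule sum.swap)
    also have "\<dots> = (\<Sum>i<r. u ! i * of_int (V (is ! i) (c # ds)))"
    proof (intro sum.cong refl)
      fix i assume "i \<in> {..<r}"
      then have "is ! i \<in> set is" by (simp add: r_def)
      with V c have "V (is ! i) (c # ds) = (\<Sum>b\<in>set is. M c (is ! i) b * V b ds)" by blast
      then show "u ! i * (\<Sum>t<r. of_int (M c (is ! i) (is ! t)) * of_int (V (is ! t) ds)) =
          u ! i * of_int (V (is ! i) (c # ds))"
        using sum_list_positions[OF assms(2), of "\<lambda>b. of_int (M c (is ! i) b) * of_int (V b ds)"]
        by (simp add: r_def)
    qed
    finally show ?case .
  qed simp
  have "linrep_seq k (L h) n = (\<Sum>t<r. foldl (\<lambda>u c. vec_mat r u (rM ! c))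
      (map alg_val (map (\<lambda>a. int_alg (h a)) is)) (digits k n) ! t * of_int (V (is ! t) []))"
    unfolding linrep_seq_def L_def prod.case Let_def rM_def[symmetric] r_def[symmetric]
    by (intro sum.cong refl) (simp add: r_def alg_val_int_alg)
  also have "\<dots> = (\<Sum>t<r. map alg_val (map (\<lambda>a. int_alg (h a)) is) ! t * of_int (V (is ! t) (digits k n)))"
    by (rule run) (rule digits_less[OF assms(1)])
  also have "\<dots> = (\<Sum>t<r. of_int (h (is ! t)) * of_int (V (is ! t) (digits k n)))"
    by (intro sum.cong refl) (simp add: r_def alg_val_int_alg)
  also have "\<dots> = of_int (\<Sum>a\<in>set is. h a * V a (digits k n))"
    using sum_list_positions[OF assms(2), of "\<lambda>a. of_int (h a) * of_int (V a (digits k n))"]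
    by (simp add: r_def)
  finally show "linrep_seq k (L h) n = of_int (\<Sum>a\<in>set is. h a * V a (digits k n))" .
qed

section \<open>The representation of the cost sequence\<close>

datatype basis = Unit | Pow | Mon nat nat nat

definition basis_set :: "nat \<Rightarrow> nat \<Rightarrow> basis set" where
  "basis_set m d = {Unit, Pow} \<union> (\<lambda>(s, i, j). Mon s i j) ` ({..<m} \<times> {..<d} \<times> {..<d})"

lemma Mon_in_basis_set: "Mon s i j \<in> basis_set m d \<longleftrightarrow> s < m \<and> i < d \<and> j < d"
  by (auto simp: basis_set_def image_iff)

lemma finite_basis_set: "finite (basis_set m d)"
  by (simp add: basis_set_def)

lemma sum_basis_set:
  "sum f (basis_set m d) = f Unit + f Pow + (\<Sum>s<m. \<Sum>i<d. \<Sum>j<d. f (Mon s i j))"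
proof -
  have "sum f (basis_set m d) = sum f {Unit, Pow} +
      sum f ((\<lambda>(s, i, j). Mon s i j) ` ({..<m} \<times> {..<d} \<times> {..<d}))"
    unfolding basis_set_def by (rule sum.union_disjoint) auto
  moreover have "sum f ((\<lambda>(s, i, j). Mon s i j) ` ({..<m} \<times> {..<d} \<times> {..<d})) =
      (\<Sum>s<m. \<Sum>i<d. \<Sum>j<d. f (Mon s i j))"
    by (subst sum.reindex) (auto simp: inj_on_def sum.cartesian_product intro!: sum.cong)
  ultimately show ?thesis by simp
qed

text \<open>One component for each selector position and each monomial in the initial registers.
  \<open>Pow\<close> is present to feed the penalties, which are the inhomogeneous part of the
  recurrence for the coefficients.\<close>

fun basis_val :: "nat \<Rightarrow> nat \<Rightarrow> rule list \<Rightarrow> basis \<Rightarrow> nat list \<Rightarrow> int" where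
  "basis_val k d rs Unit ds = 1"
| "basis_val k d rs Pow ds = int k ^ length ds"
| "basis_val k d rs (Mon s i j) ds = int k ^ length ds * cost_form d rs ds s i j"

fun basis_mat :: "nat \<Rightarrow> rule list \<Rightarrow> nat \<Rightarrow> basis \<Rightarrow> basis \<Rightarrow> int" where
  "basis_mat k rs c Unit Unit = 1"
| "basis_mat k rs c Pow Pow = int k"
| "basis_mat k rs c (Mon s i j) Pow = (if c = 0 then 0 else int k * penalty_form (rs ! s) i j)"
| "basis_mat k rs c (Mon s i j) (Mon s' i' j') =
     (if c = 0 then if s' = Suc s mod length rs \<and> i' = i \<and> j' = j then int k else 0
      else if s' = 0 then int k * (update_form (rs ! s) i' i * update_form (rs ! s) j' j) else 0)"
| "basis_mat k rs c _ _ = 0"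

lemma sum_delta_3:
  fixes f :: "nat \<Rightarrow> nat \<Rightarrow> nat \<Rightarrow> int"
  assumes "s < m" "i < d" "j < d"
  shows "(\<Sum>s'<m. \<Sum>i'<d. \<Sum>j'<d. (if s' = s \<and> i' = i \<and> j' = j then c else 0) * f s' i' j') = c * f s i j"
proof -
  have "(\<Sum>j'<d. (if s' = s \<and> i' = i \<and> j' = j then c else 0) * f s' i' j') =
      (if s' = s \<and> i' = i then c * f s' i' j else 0)" for s' i'
    using assms(3) by (cases "s' = s \<and> i' = i")
      (auto simp: if_distrib[of "\<lambda>u. u * _"] cong: if_cong)
  moreover have "(\<Sum>i'<d. if s' = s \<and> i' = i then c * f s' i' j else 0) =
      (if s' = s then c * f s' i j else 0)" for s'
    using assms(2) by (cases "s' = s") auto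
  ultimately show ?thesis using assms(1) by simp
qed

text \<open>A further digit multiplies the power of \<open>k\<close> by \<open>k\<close>. The digit
  0 merely moves the selector; any other digit adds the penalty through \<open>Pow\<close> and pulls
  the form at selector 0 back along the update.\<close>

lemma basis_val_Cons:
  assumes "a \<in> basis_set (length rs) d"
  shows "basis_val k d rs a (c # ds) =
    (\<Sum>b\<in>basis_set (length rs) d. basis_mat k rs c a b * basis_val k d rs b ds)"
proof (cases a)
  case (Mon s i j)
  then have s: "s < length rs" "i < d" "j < d" using assms by (auto simp: Mon_in_basis_set)
  then have m: "Suc s mod length rs < length rs" by (intro mod_less_divisor) linarith
  show ?thesis
  proof (cases "c = 0")
    case True
    then show ?thesis unfolding Mon sum_basis_set
      using sum_delta_3[OF m s(2,3), of "int k" "\<lambda>s' i' j'. int k ^ length ds * cost_form d rs ds s' i' j'"]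
      by simp
  next
    case False
    let ?g = "\<lambda>i' j'. int k * (update_form (rs ! s) i' i * update_form (rs ! s) j' j) *
        (int k ^ length ds * cost_form d rs ds 0 i' j')"
    have "(\<Sum>s'<length rs. \<Sum>i'<d. \<Sum>j'<d. (if s' = 0 then int k *
          (update_form (rs ! s) i' i * update_form (rs ! s) j' j) else 0) *
          (int k ^ length ds * cost_form d rs ds s' i' j')) =
        (\<Sum>s'<length rs. if s' = 0 then \<Sum>i'<d. \<Sum>j'<d. ?g i' j' else 0)"
      by (intro sum.cong refl) (auto intro!: sum.cong sum.neutral)
    also have "\<dots> = (\<Sum>i'<d. \<Sum>j'<d. ?g i' j')" using s(1) by (subst sum.delta) auto
    also have "\<dots> = int k * int k ^ length ds * (\<Sum>i'<d. \<Sum>j'<d. cost_form d rs ds 0 i' j' *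
          (update_form (rs ! s) i' i * update_form (rs ! s) j' j))"
      by (simp add: sum_distrib_left mult_ac)
    finally show ?thesis unfolding Mon sum_basis_set using False
      by (simp add: algebra_simps)
  qed
qed (simp_all add: sum_basis_set)

text \<open>Registers 2, 3, 4 of the initial configuration hold the three arguments.\<close>

definition input :: "nat list \<Rightarrow> nat \<Rightarrow> nat" where
  "input xs i = (if i < 5 then [1, 0, xs ! 0, xs ! 1, xs ! 2] ! i else 0)"

text \<open>Pairing these coefficients with the basis gives \<open>1 + k^|n| C(n)\<close>:
  \<open>Unit\<close> contributes the 1, and the monomials at selector 0 evaluate the quadratic form
  at the initial registers.\<close>

fun input_coeff :: "nat list \<Rightarrow> basis \<Rightarrow> nat" where
  "input_coeff xs Unit = 1"
| "input_coeff xs Pow = 0"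
| "input_coeff xs (Mon s i j) = (if s = 0 then input xs i * input xs j else 0)"

text \<open>These indices do not depend on the program. Therefore the encoder can be written down
  before the program whose representation it is to encode.\<close>

definition input_basis :: "basis list" where
  "input_basis = Unit # map (\<lambda>(i, j). Mon 0 i j) (List.product [0..<5] [0..<5])"

text \<open>This imitates \<open>enc_linrep\<close>, with \<open>t\<close> for the coded rest of the
  row vector and \<open>e\<close> for column vector and matrices together, so no representation has
  to be known.\<close>

definition input_code :: "nat list \<Rightarrow> nat \<Rightarrow> nat \<Rightarrow> nat \<Rightarrow> nat" where
  "input_code xs r t e = prod_encode (r, prod_encode (list_encode
     (map (\<lambda>a. enc_alg (int_alg (int (input_coeff xs a)))) input_basis @ list_decode t), e))"

lemma config_input: "config 0 (input xs) i = int (input xs i)"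
  by (auto simp: config_def input_def)

lemma input_coeff_outside: "a \<notin> set input_basis \<Longrightarrow> input_coeff xs a = 0"
proof (cases a)
  case (Mon s i j)
  assume "a \<notin> set input_basis"
  then have "s \<noteq> 0 \<or> \<not> i < 5 \<or> \<not> j < 5"
    using Mon by (force simp: input_basis_def)
  then show ?thesis using Mon by (auto simp: input_def)
qed (auto simp: input_basis_def)

text \<open>Here the three arguments play a double role, as input of the program and as parameters
  of the representation. This is the self-reference of the diagonal argument.\<close>

lemma computable_input_code:
  "computable 3 (\<lambda>xs. input_code xs (xs ! 0) (xs ! 1) (xs ! 2))"
proof -
  have inp: "computable 3 (\<lambda>xs. input xs i)" for i
  proof -
    consider "i = 0" | "i = 1" | "i = 2" | "i = 3" | "i = 4" | "\<not> i < 5" by linarith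
    then show ?thesis
      by cases (auto simp: input_def numeral_eq_Suc intro!: computable_const computable_proj
          computable_proj[of 0 "Suc (Suc (Suc 0))", simplified])
  qed
  have "computable 3 (\<lambda>xs. input_coeff xs a)" for a
  proof (cases a)
    case (Mon s i j)
    then show ?thesis by (cases "s = 0") (simp_all add: computable_const computable_mult inp)
  qed (simp_all add: computable_const)
  then show ?thesis
    unfolding input_code_def
    by (intro computable_prod_encode computable_proj computable_list_encode_append[where t = "\<lambda>xs. xs ! 1"]
        computable_enc_int_alg) auto
qed

subsection \<open>The diagonal argument\<close>

text \<open>Turns long accepting words into large numbers.\<close>

lemma length_digits_le:
  assumes "2 \<le> k"
  shows "length (digits k n) \<le> n"
proof (induction n rule: digits_induct[OF assms, case_names 0 rec])
  case (rec n)
  then have "n div k < n" using assms by simp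
  with rec.IH have "Suc (length (digits k (n div k))) \<le> n" by linarith
  then show ?case using rec.hyps assms by (simp add: digits_rec)
qed (simp add: digits_0)

lemma less_power_length_digits:
  assumes "2 \<le> k"
  shows "n < k ^ length (digits k n)"
proof (induction n rule: digits_induct[OF assms, case_names 0 rec])
  case (rec n)
  have "n div k < k ^ length (digits k (n div k))" by (rule rec.IH)
  then have "n < k * k ^ length (digits k (n div k))"
    using assms by (simp add: div_less_iff_less_mult mult.commute)
  then show ?case using rec.hyps assms by (simp add: digits_rec)
qed (simp add: digits_0)

lemma digits_surj:
  assumes "2 \<le> k" "\<And>c. c \<in> set ds \<Longrightarrow> c < k" "ds \<noteq> [] \<Longrightarrow> last ds \<noteq> 0"
  shows "\<exists>n. digits k n = ds"
  using assms(2,3)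
proof (induction ds)
  case Nil
  show ?case by (rule exI[of _ 0]) (rule digits_0)
next
  case (Cons c ds)
  have "\<exists>n. digits k n = ds"
    using Cons.IH Cons.prems by (cases "ds = []") auto
  then obtain n where n: "digits k n = ds" ..
  have c: "c < k" using Cons.prems(1) by simp
  have "c + k * n \<noteq> 0"
  proof (cases "n = 0")
    case True
    then have "ds = []" using n by (simp add: digits_0)
    then show ?thesis using Cons.prems(2) by simp
  qed (use assms(1) in simp)
  then have "digits k (c + k * n) = c # ds"
    using c n assms(1) by (simp add: digits_rec)
  then show ?case ..
qed

definition accepts :: "prog \<Rightarrow> nat list \<Rightarrow> bool" where
  "accepts p xs \<longleftrightarrow> (\<exists>\<sigma>'. (input xs, \<sigma>') \<in> prog_sem p)"

text \<open>The numbers \<open>r\<close>, \<open>t\<close> and \<open>e\<close> depend on the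
  program only and are fixed before \<open>xs\<close>, so they may themselves be used as
  arguments.\<close>

lemma linrep_of_prog:
  assumes "2 \<le> k" "prog_ok p"
  obtains r t e where "\<And>xs. \<exists>L. linrep_valid k L \<and> enc_linrep L = input_code xs r t e \<and>
    (\<forall>n. \<exists>m\<ge>1. linrep_seq k L n = real m) \<and>
    (Omega_n (linrep_seq k L) \<longleftrightarrow> \<not> accepts p xs)"
proof -
  obtain rs where idle: "(1, Eq 2 2, 1) \<in> set rs"
    and ok: "\<forall>(l, \<alpha>, l')\<in>set rs. act_ok \<alpha>"
    and run: "\<And>\<sigma>. (\<exists>\<sigma>'. ((0, \<sigma>), (1, \<sigma>')) \<in> (rule_step (set rs))\<^sup>*) \<longleftrightarrow> (\<exists>\<sigma>'. (\<sigma>, \<sigma>') \<in> prog_sem p)"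
    by (rule rules_exist[OF assms(2)]) (rule that; assumption)
  have rs: "0 < length rs" by (rule length_pos_if_in_set[OF idle])
  obtain d where d: "5 \<le> d" "\<forall>(l, \<alpha>, l')\<in>set rs. act_below d \<alpha>"
    using act_below_exists[of rs] by (elim exE conjE)
  define B where "B = basis_set (length rs) d"
  obtain rest where rest: "set rest = B - set input_basis" "distinct rest"
    using finite_distinct_list[of "B - set input_basis"] finite_basis_set by (auto simp: B_def)
  define "is" where "is = input_basis @ rest"
  have dist: "distinct is"
    using rest by (auto simp: is_def input_basis_def distinct_map inj_on_def distinct_product)
  have "set input_basis \<subseteq> B"
    using d(1) rs by (auto simp: input_basis_def B_def Mon_in_basis_set) (simp add: basis_set_def)
  then have set_is: "set is = B" using rest by (auto simp: is_def)
  define V where "V = basis_val k d rs"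
  define M where "M = basis_mat k rs"
  have V: "\<forall>a\<in>set is. \<forall>c<k. \<forall>ds. V a (c # ds) = (\<Sum>b\<in>set is. M c a b * V b ds)"
    unfolding V_def M_def set_is B_def by (intro ballI allI impI basis_val_Cons)
  define w where "w = map (\<lambda>a. int_alg (V a [])) is"
  define Ms where "Ms = map (\<lambda>c. map (\<lambda>a. map (\<lambda>b. int_alg (M c a b)) is) is) [0..<k]"
  \<comment> \<open>Outside \<open>input_basis\<close> all coefficients vanish, so this tail is the
    same for all arguments.\<close>
  define t where "t = list_encode (map (\<lambda>a. enc_alg (int_alg 0)) rest)"
  define e where "e = prod_encode (list_encode (map enc_alg w),
      list_encode (map (\<lambda>M. list_encode (map (\<lambda>row. list_encode (map enc_alg row)) M)) Ms))"
  have "\<exists>L. linrep_valid k L \<and> enc_linrep L = input_code xs (length is) t e \<and>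
    (\<forall>n. \<exists>m\<ge>1. linrep_seq k L n = real m) \<and>
    (Omega_n (linrep_seq k L) \<longleftrightarrow> \<not> accepts p xs)" for xs
  proof -
    define L where "L = (length is, map (\<lambda>a. int_alg (int (input_coeff xs a))) is, w, Ms)"
    note L = linrep_of_recurrence[OF assms(1) dist V, of "\<lambda>a. int (input_coeff xs a)",
        folded w_def Ms_def, folded L_def]
    define C where "C n = cost rs (digits k n) 0 (config 0 (input xs))" for n
    have C_quad: "C n = quad d (cost_form d rs (digits k n) 0) (config 0 (input xs))" for n
      unfolding C_def by (rule cost_quad[OF ok d(2)]) (use d(1) rs in \<open>auto simp: config_def\<close>)
    have "(\<Sum>a\<in>B. int (input_coeff xs a) * V a ds) =
        1 + int k ^ length ds * quad d (cost_form d rs ds 0) (config 0 (input xs))" for ds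
    proof -
      have "(\<Sum>s<length rs. \<Sum>i<d. \<Sum>j<d. int (input_coeff xs (Mon s i j)) * V (Mon s i j) ds) =
          (\<Sum>s<length rs. if s = 0 then \<Sum>i<d. \<Sum>j<d.
            int (input xs i * input xs j) * (int k ^ length ds * cost_form d rs ds 0 i j) else 0)"
        by (intro sum.cong refl) (auto simp: V_def intro!: sum.cong sum.neutral)
      also have "\<dots> = int k ^ length ds * quad d (cost_form d rs ds 0) (config 0 (input xs))"
        using rs by (simp add: quad_def config_input sum_distrib_left mult_ac)
      finally show ?thesis
        unfolding B_def sum_basis_set by (simp add: V_def)
    qed
    then have seq: "linrep_seq k L n = of_int (1 + int k ^ length (digits k n) * C n)" for n
      using L(2)[of n] by (simp add: set_is C_quad)
    have C_nonneg: "0 \<le> C n" for n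
      by (simp add: C_def cost_nonneg)
    have "\<exists>m\<ge>1. linrep_seq k L n = real m" for n
    proof (intro exI conjI)
      have "0 \<le> int k ^ length (digits k n) * C n" using C_nonneg by simp
      then show "1 \<le> nat (1 + int k ^ length (digits k n) * C n)"
        "linrep_seq k L n = real (nat (1 + int k ^ length (digits k n) * C n))"
        unfolding seq by linarith+
    qed
    moreover have "enc_linrep L = input_code xs (length is) t e"
    proof -
      have tail: "map (\<lambda>a. enc_alg (int_alg (int (input_coeff xs a)))) rest =
          map (\<lambda>a. enc_alg (int_alg 0)) rest"
        using rest(1) input_coeff_outside[of _ xs] by auto
      show ?thesis
        by (simp add: tail enc_linrep_def L_def input_code_def e_def t_def is_def comp_def del: map_eq_conv)
    qed
    moreover have "Omega_n (linrep_seq k L) \<longleftrightarrow> \<not> accepts p xs"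
    proof
      assume "Omega_n (linrep_seq k L)"
      then obtain c n0 where c: "c > 0" "\<And>n. n \<ge> n0 \<Longrightarrow> linrep_seq k L n \<ge> c * real n"
        unfolding Omega_n_def by blast
      show "\<not> accepts p xs"
      proof
        assume "accepts p xs"
        then obtain \<sigma>' where \<sigma>': "((0, input xs), (1, \<sigma>')) \<in> (rule_step (set rs))\<^sup>*"
          unfolding accepts_def run[symmetric] by (elim exE)
        \<comment> \<open>From \<open>N\<close> on the bound \<open>c * n\<close> exceeds 1, whereas
          the sequence has the value 1 at the number of an accepting word.\<close>
        obtain N where N: "1 / c < real N" using reals_Archimedean2 by blast
        obtain ds where ds: "accepting_word rs (config 0 (input xs)) ds" "max n0 N \<le> length ds"
          using run_imp_accepting_word[OF \<sigma>' idle ok, of "max n0 N"] by (elim exE conjE)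
        have "c < k" if "c \<in> set ds" for c
          using ds(1) that assms(1) by (auto simp: accepting_word_def)
        then obtain n where n: "digits k n = ds"
          using digits_surj[OF assms(1), of ds] ds(1) by (auto simp: accepting_word_def)
        have le: "n0 \<le> n" "N \<le> n" using length_digits_le[OF assms(1), of n] n ds(2) by auto
        have "C n = 0" using ds(1) n by (simp add: C_def accepting_word_def)
        then have "c * real n \<le> 1" using c(2)[OF le(1)] seq[of n] by simp
        moreover have "1 < c * real N" using N c(1) by (simp add: field_simps)
        moreover have "c * real N \<le> c * real n" using le(2) c(1) by simp
        ultimately show False by linarith
      qed
    next
      assume rej: "\<not> accepts p xs"
      \<comment> \<open>Without an accepting run the integer \<open>C n\<close> is at least 1, so
        the factor \<open>k^|n|\<close>, which exceeds \<open>n\<close>, gives the bound with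
        constant 1.\<close>
      have "1 * real n \<le> linrep_seq k L n" for n
      proof -
        have "C n \<noteq> 0"
        proof
          assume "C n = 0"
          from cost_0_imp_run[OF this[unfolded C_def] rs ok] rej show False
            unfolding accepts_def run[symmetric] by (elim notE)
        qed
        then have "1 \<le> C n" using C_nonneg[of n] by linarith
        then have "int k ^ length (digits k n) * 1 \<le> int k ^ length (digits k n) * C n"
          by (intro mult_left_mono) auto
        moreover have "int n < int k ^ length (digits k n)"
          using less_power_length_digits[OF assms(1), of n]
          by (metis of_nat_less_iff of_nat_power)
        ultimately have "int n \<le> 1 + int k ^ length (digits k n) * C n" by linarith
        then show ?thesis unfolding seq by linarith
      qed
      then show "Omega_n (linrep_seq k L)"
        unfolding Omega_n_def by (intro exI[of _ 1]) auto
    qed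
    ultimately show ?thesis using L(1) by blast
  qed
  then show ?thesis by (rule that)
qed

lemma map_input: "length xs = 3 \<Longrightarrow> map (input xs) [2, 3, 4] = xs"
  by (auto simp: input_def numeral_eq_Suc length_Suc_conv)

text \<open>The program computes \<open>q\<close> from registers 2, 3, 4 into 5 and compares the
  result with 1 in register 6. It accepts if \<open>q\<close> answers yes, which then spoils linear
  growth.\<close>

lemma accepting_prog_exists:
  obtains p where "prog_ok p" "\<And>xs. length xs = 3 \<Longrightarrow> accepts p xs \<longleftrightarrow> rec_eval q xs 1"
proof -
  obtain c where c: "implements c q [2, 3, 4] 5 6"
    by (rule implementableD[OF recf_implementable, of "[2, 3, 4]" 6 5]) auto
  define p where "p = Seq c (Seq (Set_to 6 1) (Test 5 6))"
  show ?thesis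
  proof (rule that[of p])
    show "prog_ok p" using implements_ok[OF c] by (simp add: p_def)
    fix xs :: "nat list" assume "length xs = 3"
    note xs = map_input[OF this]
    have "accepts p xs \<longleftrightarrow> (\<exists>\<tau>. (input xs, \<tau>) \<in> prog_sem c \<and> \<tau> 5 = 1)"
      unfolding accepts_def p_def by (auto simp: relcomp_unfold)
    also have "\<dots> \<longleftrightarrow> rec_eval q xs 1"
      using implements_sound(2)[OF c, of "input xs"] implements_complete[OF c, of "input xs" 1]
      unfolding xs by metis
    finally show "accepts p xs \<longleftrightarrow> rec_eval q xs 1" .
  qed
qed

theorem theorem3p1:
  fixes k :: nat and S :: "real set"
  assumes "k \<ge> 2"
    and "{real n | n::nat. n \<ge> 1} \<subseteq> S"
    and "S \<subseteq> {x. algebraic x}"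
  shows "\<not> omega_problem_decidable k S"
proof
  assume "omega_problem_decidable k S"
  then obtain p where p: "\<And>L. linrep_valid k L \<Longrightarrow> (\<And>n. linrep_seq k L n \<in> S) \<Longrightarrow>
      rec_eval p [enc_linrep L] (if Omega_n (linrep_seq k L) then 1 else 0)"
    unfolding omega_problem_decidable_def by blast
  obtain pc where pc: "\<And>xs. length xs = 3 \<Longrightarrow> rec_eval pc xs (input_code xs (xs ! 0) (xs ! 1) (xs ! 2))"
    using computable_input_code unfolding computable_def by blast
  \<comment> \<open>The supposed decision procedure after the encoder; a program for
    \<open>q\<close> is compiled first and its parameters are inserted afterwards.\<close>
  define q where "q = Comp p [pc]"
  have q: "rec_eval q xs y" if "length xs = 3" "rec_eval p [input_code xs (xs ! 0) (xs ! 1) (xs ! 2)] y" for xs y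
    unfolding q_def by (rule ev_comp[OF _ that(2)]) (use pc[OF that(1)] in simp)
  obtain P where P: "prog_ok P" "\<And>xs. length xs = 3 \<Longrightarrow> accepts P xs \<longleftrightarrow> rec_eval q xs 1"
    by (rule accepting_prog_exists[of q]) (rule that; assumption)
  obtain r t e where rte: "\<And>xs. \<exists>L. linrep_valid k L \<and> enc_linrep L = input_code xs r t e \<and>
      (\<forall>n. \<exists>m\<ge>1. linrep_seq k L n = real m) \<and>
      (Omega_n (linrep_seq k L) \<longleftrightarrow> \<not> accepts P xs)"
    by (rule linrep_of_prog[OF assms(1) P(1)]) (rule that; assumption)
  \<comment> \<open>With these arguments the code of the representation is exactly what the encoder
    computes from \<open>xs\<close>.\<close>
  define xs where "xs = [r, t, e]"
  obtain L where L: "linrep_valid k L" "enc_linrep L = input_code xs r t e"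
    "\<forall>n. \<exists>m\<ge>1. linrep_seq k L n = real m" "Omega_n (linrep_seq k L) \<longleftrightarrow> \<not> accepts P xs"
    using rte[of xs] by blast
  have S: "linrep_seq k L n \<in> S" for n
  proof -
    obtain m where "1 \<le> m" "linrep_seq k L n = real m" using L(3) by blast
    then show ?thesis using assms(2) by auto
  qed
  have "rec_eval q xs (if Omega_n (linrep_seq k L) then 1 else 0)"
    by (rule q) (use p[OF L(1) S] L(2) in \<open>simp_all add: xs_def\<close>)
  then have ev: "rec_eval q xs (if accepts P xs then 0 else 1)"
    using L(4) by auto
  have acc: "accepts P xs \<longleftrightarrow> rec_eval q xs 1"
    by (rule P(2)) (simp add: xs_def)
  \<comment> \<open>Acceptance means that \<open>q\<close> answers 1, yet correctness then forces 0;
    rejection makes the correct answer 1, which means acceptance.\<close>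
  show False
  proof (cases "accepts P xs")
    case True
    then have "rec_eval q xs 1" "rec_eval q xs 0" using acc ev by auto
    then have "(1::nat) = 0" by (rule rec_eval_deterministic)
    then show False by simp
  next
    case False
    then show False using acc ev by simp
  qed
qed

end
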